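(* Let $P\in\mathbb{C}^{(d+N)\times(d+N)}$ be a symmetric Gaussian generator matrix, $p(x,\theta)=\langle(x,\theta),P(x,\theta)\rangle$, and let $u\in\mathscr{S}'(\mathbb{R}^d)$ be the oscillatory integral $u(x)=\int_{\mathbb{R}^N}e^{ip(x,\theta)}\,d\theta$ (for $N=0$, $u(x)=e^{ip(x)}$). Let $$\lambda=\{(x,p'_x(x,\theta))\in T^*\mathbb{C}^d:\ p'_\theta(x,\theta)=0,\ (x,\theta)\in\mathbb{C}^{d+N}\}$$ be the associated positive Lagrangian. Then $$WF(u)\subseteq(\lambda\cap T^*\mathbb{R}^d)\setminus\{0\}.$$
   Context: A symmetric $P=\begin{pmatrix}P_{xx}&P_{x\theta}\\P_{\theta x}&P_{\theta\theta}\end{pmatrix}$ (blocks of sizes $d\times d$, $d\times N$, $N\times d$, $N\times N$) is a Gaussian generator matrix if ${\rm Im}\,P\ge0$ and the rows of $(P_{\theta x}\ P_{\theta\theta})$ are linearly independent over $\mathbb{C}$ (condition void if $N=0$). For such $P$ the integral $\int e^{ip(x,\theta)}d\theta$ is defined as a tempered distribution by regularization (integration by parts in $\theta$ against test functions); it coincides with the absolutely convergent Lebesgue integral when ${\rm Im}\,P>0$. $\langle\cdot,\cdot\rangle$ is bilinear. Gabor wave front set: fix $\varphi\in\mathscr{S}(\mathbb{R}^d)\setminus\{0\}$, define the short-time Fourier transform $V_\varphi u(x,\xi)=(u,M_\xi T_x\varphi)$ with $T_x f(y)=f(y-x)$, $M_\xi f(y)=e^{i\langle y,\xi\rangle}f(y)$,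 $(\cdot,\cdot)$ the conjugate-linear pairing. For $u\in\mathscr{S}'(\mathbb{R}^d)$, a point $z_0\in T^*\mathbb{R}^d\setminus\{0\}$ is not in $WF(u)$ iff there is an open conic set $\Gamma\ni z_0$ in $T^*\mathbb{R}^d\setminus\{0\}$ with $\sup_{z\in\Gamma}\langle z\rangle^N|V_\varphi u(z)|<\infty$ for all $N\ge0$, where $\langle z\rangle=(1+|z|^2)^{1/2}$ (independent of $\varphi$). $T^*\mathbb{R}^d$ is viewed as the real subspace of $T^*\mathbb{C}^d$. *)

theory Defs
  imports "HOL-Analysis.Analysis" "HOL-Probability.Probability"
begin

text \<open>Variables (x,theta) in C^(d+N) are indexed by the type 'd + nat:
  Inl i (i :: 'd) for the x-part, Inr k (k < N) for the theta-part.\<close>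

definition idx :: "nat \<Rightarrow> ('d + nat) set" where
  "idx N = range Inl \<union> Inr ` {..<N}"

definition qform :: "('d + nat \<Rightarrow> 'd + nat \<Rightarrow> complex) \<Rightarrow> nat \<Rightarrow> ('d::finite + nat \<Rightarrow> complex) \<Rightarrow> complex" where
  "qform P N w = (\<Sum>i\<in>idx N. \<Sum>j\<in>idx N. w i * P i j * w j)"

definition pderiv_q :: "('d + nat \<Rightarrow> 'd + nat \<Rightarrow> complex) \<Rightarrow> nat \<Rightarrow> ('d::finite + nat \<Rightarrow> complex) \<Rightarrow> 'd + nat \<Rightarrow> complex" where
  "pderiv_q P N w k = deriv (\<lambda>t::complex. qform P N (w(k := w k + t))) 0"

definition gaussian_generator :: "('d::finite + nat \<Rightarrow> 'd + nat \<Rightarrow> complex) \<Rightarrow> nat \<Rightarrow> bool" where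
  "gaussian_generator P N \<longleftrightarrow>
     (\<forall>i\<in>idx N. \<forall>j\<in>idx N. P i j = P j i) \<and>
     (\<forall>v :: 'd + nat \<Rightarrow> real. 0 \<le> (\<Sum>i\<in>idx N. \<Sum>j\<in>idx N. v i * Im (P i j) * v j)) \<and>
     (\<forall>c :: nat \<Rightarrow> complex. (\<forall>j\<in>idx N. (\<Sum>k<N. c k * P (Inr k) j) = 0) \<longrightarrow> (\<forall>k<N. c k = 0))"

definition join :: "(complex^'d) \<Rightarrow> (nat \<Rightarrow> complex) \<Rightarrow> ('d::finite + nat \<Rightarrow> complex)" where
  "join x \<theta> = case_sum (\<lambda>i. x $ i) \<theta>"

definition lagrangian :: "('d + nat \<Rightarrow> 'd + nat \<Rightarrow> complex) \<Rightarrow> nat \<Rightarrow> ((complex^'d) \<times> (complex^'d)) set" where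
  "lagrangian P N = {(x, \<xi>). \<exists>\<theta> :: nat \<Rightarrow> complex.
      (\<forall>k<N. pderiv_q P N (join x \<theta>) (Inr k) = 0) \<and>
      (\<forall>i. \<xi> $ i = pderiv_q P N (join x \<theta>) (Inl i))}"

definition cvec :: "real^'d \<Rightarrow> complex^'d" where
  "cvec x = (\<chi> i. complex_of_real (x $ i))"

definition real_part_lagr :: "((complex^'d) \<times> (complex^'d)) set \<Rightarrow> ((real^'d) \<times> (real^'d)) set" where
  "real_part_lagr L = {(x, \<xi>). (cvec x, cvec \<xi>) \<in> L}"

definition window :: "real^'d \<Rightarrow> real" where
  "window y = exp (- (norm y)\<^sup>2 / 2)"

text \<open>Short-time Fourier transform V_phi u(x,xi) = (u, M_xi T_x phi) = u(conj(M_xi T_x phi)) of the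
  oscillatory integral u(y) = int e^{i p(y,theta)} dtheta, the regularized integral being
  realised as the limit of Gaussian cut-offs e^{-eps|theta|^2}, eps -> 0+.  For N = 0 the
  theta-measure is the one-point measure and u(y) = e^{i p(y)}.\<close>
definition stft_osc :: "('d::finite + nat \<Rightarrow> 'd + nat \<Rightarrow> complex) \<Rightarrow> nat \<Rightarrow> (real^'d) \<times> (real^'d) \<Rightarrow> complex" where
  "stft_osc P N z = (case z of (x, \<xi>) \<Rightarrow>
     Lim (at_right (0::real)) (\<lambda>\<epsilon>.
       integral\<^sup>L lborel (\<lambda>y :: real^'d.
         integral\<^sup>L (PiM {..<N} (\<lambda>_. lborel)) (\<lambda>\<theta> :: nat \<Rightarrow> real.
           exp (\<i> * qform P N (join (cvec y) (\<lambda>k. complex_of_real (\<theta> k)))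
                - complex_of_real (\<epsilon> * (\<Sum>k<N. (\<theta> k)\<^sup>2)))
           * complex_of_real (window (y - x))
           * exp (- \<i> * complex_of_real (inner y \<xi>))))))"

text \<open>Gabor wave front set of a distribution given through its STFT V.\<close>
definition conic :: "((real^'d) \<times> (real^'d)) set \<Rightarrow> bool" where
  "conic \<Gamma> \<longleftrightarrow> (\<forall>z\<in>\<Gamma>. \<forall>t::real. t > 0 \<longrightarrow> t *\<^sub>R z \<in> \<Gamma>)"

definition gabor_wf :: "((real^'d) \<times> (real^'d) \<Rightarrow> complex) \<Rightarrow> ((real^'d) \<times> (real^'d)) set" where
  "gabor_wf V = {z0. z0 \<noteq> 0 \<and> \<not> (\<exists>\<Gamma>. open \<Gamma> \<and> conic \<Gamma> \<and> 0 \<notin> \<Gamma> \<and> z0 \<in> \<Gamma> \<and>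
      (\<forall>n::real. n \<ge> 0 \<longrightarrow> (\<exists>C. \<forall>z\<in>\<Gamma>. (1 + (norm z)\<^sup>2) powr (n / 2) * norm (V z) \<le> C)))}"

end

theory Submission
  imports Defs "HOL-Complex_Analysis.Complex_Analysis"
begin

text \<open>
  The regularised short-time Fourier transform at \<open>z = (x, \<xi>)\<close> is a Gaussian integral over
  \<open>(y, \<theta>)\<close> with matrix \<open>A\<^sub>\<epsilon> = - \<i>P + diag (1/2, \<epsilon>)\<close> and linear term \<open>b = (x - \<i>\<xi>, 0)\<close>. The real part
  of \<open>A\<^sub>\<epsilon>\<close> is positive definite, and \<open>A\<^sub>0\<close> is still invertible by the rank condition, although its
  real part is only semidefinite. Hence the limit is \<open>C exp (\<langle>b, v\<rangle>/2 - |x|\<^sup>2/2)\<close> with \<open>2 A\<^sub>0 v = b\<close>; the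
  limit is computed by eliminating one variable at a time, choosing pivots of \<open>A\<^sub>0\<close> so that no
  Gaussian factor degenerates.

  If \<open>a\<close> is the difference between the position part of \<open>v\<close> and \<open>x\<close>, then \<open>v\<close> lies over the point
  \<open>(x + a, \<xi> - \<i>a)\<close> of the Lagrangian. Nonnegativity of \<open>Im \<langle>cnj v, P v\<rangle>\<close> bounds the real part
  of the exponent by \<open>- |a|\<^sup>2/2\<close>. As \<open>a\<close> is linear in \<open>z\<close> and vanishes only on the real points
  of the Lagrangian, the transform decays like a Gaussian in a cone around every other \<open>z\<close>.
\<close>

subsection \<open>The one-dimensional complex Gaussian\<close>

text \<open>Differentiation under the integral sign. A local integrable majorant of \<open>f\<close>
  also controls its derivative in the parameter, by Cauchy's estimate on slightly smaller discs, so
  the difference quotients converge dominatedly.\<close>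

lemma holomorphic_on_integral:
  fixes f :: "complex \<Rightarrow> 'a \<Rightarrow> complex"
  assumes "open S"
    and hol: "\<And>x. (\<lambda>z. f z x) holomorphic_on S"
    and meas: "\<And>z. z \<in> S \<Longrightarrow> f z \<in> borel_measurable M"
    and dom: "\<And>z. z \<in> S \<Longrightarrow>
      \<exists>r>0. \<exists>g. ball z r \<subseteq> S \<and> integrable M g \<and> (\<forall>w\<in>ball z r. \<forall>x. norm (f w x) \<le> g x)"
  shows "(\<lambda>z. integral\<^sup>L M (f z)) holomorphic_on S"
proof -
  have "\<exists>D. ((\<lambda>z. integral\<^sup>L M (f z)) has_field_derivative D) (at z)" if z: "z \<in> S" for z
  proof -
    obtain r g where r: "r > 0" and sub: "ball z r \<subseteq> S" and g: "integrable M g"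
      and le: "\<And>w x. w \<in> ball z r \<Longrightarrow> norm (f w x) \<le> g x"
      using dom[OF z] by blast
    have zr: "z \<in> ball z r" using r by simp
    have int: "integrable M (f w)" if "w \<in> ball z r" for w
      by (rule Bochner_Integration.integrable_bound[OF g])
        (use that sub le meas in \<open>auto intro!: order_trans[OF le]\<close>)
    have df: "((\<lambda>z. f z x) has_field_derivative deriv (\<lambda>z. f z x) w) (at w)" if "w \<in> S" for w x
      using holomorphic_derivI[OF hol \<open>open S\<close> that] .
    \<comment> \<open>Since 1/2 + 1/3 < 1, the disc of radius r/3 around a point of
      \<open>ball z (r/2)\<close> stays in the region where \<open>g\<close> dominates.\<close>
    have bd: "norm (deriv (\<lambda>z. f z x) w) \<le> 3 * g x / r" if w: "w \<in> ball z (r/2)" for w x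
    proof -
      have sub': "cball w (r/3) \<subseteq> ball z r"
      proof
        fix u assume "u \<in> cball w (r/3)"
        then show "u \<in> ball z r"
          using w dist_triangle[of z u w] r by (simp add: dist_commute)
      qed
      have "norm ((deriv ^^ 1) (\<lambda>z. f z x) w) \<le> fact 1 * g x / (r/3) ^ 1"
      proof (rule Cauchy_inequality)
        show "(\<lambda>z. f z x) holomorphic_on ball w (r/3)"
          using hol by (rule holomorphic_on_subset) (use sub sub' in force)
        show "continuous_on (cball w (r/3)) (\<lambda>z. f z x)"
          by (rule holomorphic_on_imp_continuous_on, rule holomorphic_on_subset[OF hol])
            (use sub sub' in force)
        show "cmod (f u x) \<le> g x" if "cmod (w - u) = r/3" for u
          by (rule le) (use that sub' in \<open>auto simp: dist_norm\<close>)
      qed (use r in simp)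
      then show ?thesis by (simp add: field_simps)
    qed
    \<comment> \<open>The derivative bound on the convex ball becomes a Lipschitz bound, which is
      the majorant of the difference quotients.\<close>
    have lip: "norm (f w x - f z x) \<le> (3 * g x / r) * norm (w - z)" if w: "w \<in> ball z (r/2)" for w x
    proof (rule field_differentiable_bound[where S = "ball z (r/2)"])
      show "((\<lambda>z. f z x) has_field_derivative deriv (\<lambda>z. f z x) u) (at u within ball z (r/2))"
        if "u \<in> ball z (r/2)" for u
        using that sub r by (intro has_field_derivative_at_within[OF df]) auto
      show "norm (deriv (\<lambda>z. f z x) u) \<le> 3 * g x / r" if "u \<in> ball z (r/2)" for u
        using bd[OF that] .
    qed (use w r in auto)
    let ?D = "\<integral>x. deriv (\<lambda>z. f z x) z \<partial>M"
    have "((\<lambda>w. (integral\<^sup>L M (f w) - integral\<^sup>L M (f z)) / (w - z)) \<longlongrightarrow> ?D) (at z)"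
      unfolding tendsto_at_iff_sequentially comp_def
    proof (intro allI impI)
      fix X :: "nat \<Rightarrow> complex"
      assume X: "\<forall>i. X i \<in> UNIV - {z}" and lim: "X \<longlonglongrightarrow> z"
      have "eventually (\<lambda>n. X n \<in> ball z (r/2)) sequentially"
        using topological_tendstoD[OF lim, of "ball z (r/2)"] r by simp
      then obtain n0 where n0: "\<And>n. n \<ge> n0 \<Longrightarrow> X n \<in> ball z (r/2)"
        by (auto simp: eventually_sequentially)
      \<comment> \<open>Only a tail of \<open>X\<close> is sure to lie in the ball, while dominated
        convergence asks for the bound at every index.\<close>
      define Y where "Y n = X (n + n0)" for n
      have Y: "Y n \<in> ball z (r/2)" "Y n \<in> ball z r" "Y n \<noteq> z" for n
        using n0[of "n + n0"] X r by (auto simp: Y_def)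
      have Ylim: "Y \<longlonglongrightarrow> z"
        unfolding Y_def using lim by (rule LIMSEQ_ignore_initial_segment)
      let ?q = "\<lambda>n x. (f (Y n) x - f z x) / (Y n - z)"
      have qm: "?q n \<in> borel_measurable M" for n
        using meas[of "Y n"] meas[OF z] Y(2)[of n] sub by auto
      have ql: "(\<lambda>n. ?q n x) \<longlonglongrightarrow> deriv (\<lambda>z. f z x) z" for x
        using df[OF z, of x] Ylim Y(3)
        unfolding has_field_derivative_iff tendsto_at_iff_sequentially comp_def by blast
      have "(\<lambda>n. integral\<^sup>L M (?q n)) \<longlonglongrightarrow> ?D"
      proof (rule integral_dominated_convergence)
        show "(\<lambda>x. deriv (\<lambda>z. f z x) z) \<in> borel_measurable M"
          by (rule borel_measurable_LIMSEQ_metric[OF qm]) (rule ql)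
        show "integrable M (\<lambda>x. 3 * g x / r)" using g by simp
        show "AE x in M. norm (?q n x) \<le> 3 * g x / r" for n
          using lip[OF Y(1)[of n]] Y(3)[of n] by (simp add: norm_divide pos_divide_le_eq)
      qed (use qm ql in auto)
      moreover have "integral\<^sup>L M (?q n) = (integral\<^sup>L M (f (Y n)) - integral\<^sup>L M (f z)) / (Y n - z)" for n
        using int[OF Y(2)[of n]] int[OF zr] by (simp add: Bochner_Integration.integral_diff)
      ultimately show "(\<lambda>n. (integral\<^sup>L M (f (X n)) - integral\<^sup>L M (f z)) / (X n - z)) \<longlonglongrightarrow> ?D"
        using LIMSEQ_offset[of "\<lambda>n. (integral\<^sup>L M (f (X n)) - integral\<^sup>L M (f z)) / (X n - z)" n0]
        by (simp only: Y_def)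
    qed
    then show ?thesis by (auto simp: has_field_derivative_iff)
  qed
  then show ?thesis
    using \<open>open S\<close> by (auto simp: holomorphic_on_open)
qed

lemma integrable_real_gaussian:
  assumes "0 < (a::real)"
  shows "integrable lborel (\<lambda>t::real. exp (- a * t\<^sup>2))"
    and "(\<integral>t. exp (- a * t\<^sup>2) \<partial>lborel) = sqrt (pi / a)"
proof -
  \<comment> \<open>The standard deviation for which the exponent of the centred normal density is
    \<open>- a * t\<^sup>2\<close>; the density has mass 1.\<close>
  define s where "s = sqrt (1 / (2 * a))"
  have s: "2 * s\<^sup>2 = 1 / a" using assms by (simp add: s_def)
  have eq: "exp (- a * t\<^sup>2) = sqrt (pi / a) * normal_density 0 s t" for t
  proof -
    have "2 * pi * s\<^sup>2 = pi / a" "t\<^sup>2 / (2 * s\<^sup>2) = a * t\<^sup>2"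
      using assms by (simp_all add: s_def)
    then show ?thesis using assms by (simp add: normal_density_def)
  qed
  have "0 < s" using assms by (simp add: s_def)
  then show "integrable lborel (\<lambda>t::real. exp (- a * t\<^sup>2))"
    and "(\<integral>t. exp (- a * t\<^sup>2) \<partial>lborel) = sqrt (pi / a)"
    unfolding eq by auto
qed

text \<open>Half of the quadratic term absorbs the linear one: the difference of the exponents is
  the square \<open>(a * t - b)\<^sup>2 / (2 * a)\<close>.\<close>

lemma gaussian_linear_bound:
  assumes "0 < (a::real)"
  shows "exp (- a * t\<^sup>2 + b * t) \<le> exp (b\<^sup>2 / (2 * a)) * exp (- (a / 2) * t\<^sup>2)"
proof -
  have "0 \<le> (a * t - b)\<^sup>2 / (2 * a)" using assms by simp
  also have "\<dots> = b\<^sup>2 / (2 * a) + a / 2 * t\<^sup>2 - b * t"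
    using assms by (simp add: field_simps power2_eq_square)
  finally show ?thesis by (simp add: exp_add[symmetric])
qed

lemma gaussian_linear_integrable:
  assumes "0 < (a::real)"
  shows "integrable lborel (\<lambda>t::real. exp (- a * t\<^sup>2 + b * t))"
  by (rule Bochner_Integration.integrable_bound
        [where f="\<lambda>t. exp (b\<^sup>2 / (2 * a)) * exp (- (a / 2) * t\<^sup>2)"])
     (use gaussian_linear_bound[OF assms] integrable_real_gaussian(1)[of "a/2"] assms in auto)

text \<open>Keeps the argument of \<open>csqrt\<close> off its branch cut. The imaginary axis is
  included because the limiting pivots may lie there. If \<open>pi / a\<close> were a real r \<le>
  0, then \<open>pi = r * Re a\<close> could not be positive.\<close>

lemma pi_divide_notin_nonpos_Reals:
  fixes a :: complex
  assumes "0 \<le> Re a" "a \<noteq> 0"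
  shows "pi / a \<notin> \<real>\<^sub>\<le>\<^sub>0"
proof
  assume "pi / a \<in> \<real>\<^sub>\<le>\<^sub>0"
  then obtain r where "r \<le> 0" "pi / a = complex_of_real r"
    by (auto elim!: nonpos_Reals_cases)
  then have "complex_of_real pi = of_real r * a"
    using assms(2) by (metis nonzero_divide_eq_eq)
  then have "Re (complex_of_real pi) = Re (of_real r * a)" by (rule arg_cong)
  then have "pi = r * Re a" by simp
  then show False
    using \<open>r \<le> 0\<close> assms(1) mult_nonpos_nonneg[of r "Re a"] pi_gt_zero by simp
qed

text \<open>Both sides are holomorphic in \<open>a\<close> on the right half-plane and agree on the
  positive reals, where the formula is the real one.\<close>

lemma complex_gaussian_integral_centered:
  fixes a :: complex
  assumes "0 < Re a"
  shows "(\<integral>t. exp (- a * (complex_of_real t)\<^sup>2) \<partial>lborel) = csqrt (pi / a)"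
proof -
  define S where "S = {a::complex. 0 < Re a}"
  have "open S" unfolding S_def by (rule open_halfspace_Re_gt)
  have "convex S" unfolding S_def by (rule convex_halfspace_Re_gt)
  let ?F = "\<lambda>a. \<integral>t. exp (- a * (complex_of_real t)\<^sup>2) \<partial>lborel"
  have F: "?F holomorphic_on S"
  proof (rule holomorphic_on_integral[OF \<open>open S\<close>])
    fix z assume z: "z \<in> S"
    \<comment> \<open>On this disc the real part stays above \<open>Re z / 2\<close>, so a single
      real Gaussian dominates all integrands.\<close>
    let ?r = "Re z / 2"
    have *: "?r < Re w" if "w \<in> ball z ?r" for w
      using that abs_Re_le_cmod[of "z - w"] by (simp add: dist_norm)
    show "\<exists>r>0. \<exists>g. ball z r \<subseteq> S \<and> integrable lborel g \<and>
        (\<forall>w\<in>ball z r. \<forall>t. norm (exp (- w * (complex_of_real t)\<^sup>2)) \<le> g t)"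
    proof (intro exI conjI ballI allI)
      show "0 < ?r" using z by (simp add: S_def)
      then show "ball z ?r \<subseteq> S" using * by (force simp: S_def)
      show "integrable lborel (\<lambda>t::real. exp (- ?r * t\<^sup>2))"
        using \<open>0 < ?r\<close> by (rule integrable_real_gaussian)
      show "norm (exp (- w * (complex_of_real t)\<^sup>2)) \<le> exp (- ?r * t\<^sup>2)" if "w \<in> ball z ?r" for w t
        using mult_right_mono[OF less_imp_le[OF *[OF that]], of "t\<^sup>2"]
        by (simp add: power2_eq_square)
    qed
  qed (auto intro!: holomorphic_intros)
  have G: "(\<lambda>a. csqrt (pi / a)) holomorphic_on S"
    by (intro holomorphic_intros) (auto simp: S_def intro: pi_divide_notin_nonpos_Reals[THEN notE, rotated 2])
  have "?F a - csqrt (pi / a) = 0"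
  proof (rule analytic_continuation[where f = "\<lambda>a. ?F a - csqrt (pi / a)" and S = S and U = "complex_of_real ` {0<..}" and \<xi> = 1])
    show "(\<lambda>a. ?F a - csqrt (pi / a)) holomorphic_on S"
      using F G by (rule holomorphic_on_diff)
    show "connected S" using \<open>convex S\<close> by (rule convex_connected)
    show "(1::complex) islimpt complex_of_real ` {0<..}"
    proof -
      have "(1::real) islimpt {0<..}"
        by (rule interior_limit_point) (simp add: interior_open)
      then show ?thesis
        using islimpt_isCont_image[of 1 "{0<..}" complex_of_real] 
        by (simp add: eventually_at_filter)
    qed
    fix z assume "z \<in> complex_of_real ` {0<..}"
    then obtain r where r: "0 < r" "z = of_real r" by auto
    have "?F z = (\<integral>t. complex_of_real (exp (- r * t\<^sup>2)) \<partial>lborel)"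
      by (simp add: r exp_of_real[symmetric])
    also have "\<dots> = complex_of_real (sqrt (pi / r))"
      using integrable_real_gaussian(2)[OF r(1)] by simp
    finally show "?F z - csqrt (pi / z) = 0"
      using r csqrt_of_real_nonneg[of "pi / r"] by simp
  qed (use assms \<open>open S\<close> in \<open>auto simp: S_def\<close>)
  then show ?thesis by simp
qed

text \<open>Both sides are entire in \<open>b\<close>. For b = 2ar with r real, completing the
  square only translates t by the real number r, so the centred formula applies; these b form a
  line, which suffices for continuation.\<close>

lemma complex_gaussian_integral:
  fixes a b :: complex
  assumes a: "0 < Re a"
  shows "(\<integral>t. exp (- a * (complex_of_real t)\<^sup>2 + b * complex_of_real t) \<partial>lborel)
    = csqrt (pi / a) * exp (b\<^sup>2 / (4 * a))"
proof -
  have [simp]: "a \<noteq> 0" using a by auto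
  let ?F = "\<lambda>b. \<integral>t. exp (- a * (complex_of_real t)\<^sup>2 + b * complex_of_real t) \<partial>lborel"
  let ?G = "\<lambda>b. csqrt (pi / a) * exp (b\<^sup>2 / (4 * a))"
  have F: "?F holomorphic_on UNIV"
  proof (rule holomorphic_on_integral[OF open_UNIV])
    fix z :: complex
    let ?R = "cmod z + 1"
    \<comment> \<open>The two signs together dominate the exponential of
      \<open>?R * \<bar>t\<bar>\<close>.\<close>
    let ?g = "\<lambda>t. exp (- Re a * t\<^sup>2 + ?R * t) + exp (- Re a * t\<^sup>2 + (- ?R) * t)"
    show "\<exists>r>0. \<exists>g. ball z r \<subseteq> UNIV \<and> integrable lborel g \<and>
        (\<forall>w\<in>ball z r. \<forall>t. norm (exp (- a * (complex_of_real t)\<^sup>2 + w * complex_of_real t)) \<le> g t)"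
    proof (intro exI conjI ballI allI)
      show "0 < (1::real)" by simp
      show "integrable lborel ?g"
        using a by (intro Bochner_Integration.integrable_add gaussian_linear_integrable)
      fix w t assume "w \<in> ball z 1"
      then have "\<bar>Re w\<bar> \<le> ?R"
        using abs_Re_le_cmod[of w] norm_triangle_ineq3[of w z] by (simp add: dist_norm norm_minus_commute)
      then have "\<bar>Re w * t\<bar> \<le> ?R * \<bar>t\<bar>" by (simp add: abs_mult mult_right_mono)
      then have "Re w * t \<le> ?R * t \<or> Re w * t \<le> - ?R * t"
        by (cases "0 \<le> t") (auto simp only: abs_of_nonneg abs_of_neg not_le)
      then have "exp (- Re a * t\<^sup>2 + Re w * t) \<le> exp (- Re a * t\<^sup>2 + ?R * t) \<or>
        exp (- Re a * t\<^sup>2 + Re w * t) \<le> exp (- Re a * t\<^sup>2 + (- ?R) * t)" by auto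
      then have "exp (- Re a * t\<^sup>2 + Re w * t) \<le> ?g t"
        by (smt (verit) exp_gt_zero)
      then show "norm (exp (- a * (complex_of_real t)\<^sup>2 + w * complex_of_real t)) \<le> ?g t"
        by (simp add: power2_eq_square)
    qed auto
  qed (auto intro!: holomorphic_intros)
  have "?F b - ?G b = 0"
  proof (rule analytic_continuation[where f = "\<lambda>b. ?F b - ?G b" and S = UNIV and U = "(\<lambda>r. 2 * a * complex_of_real r) ` UNIV" and \<xi> = 0])
    show "(\<lambda>b. ?F b - ?G b) holomorphic_on UNIV"
      by (intro holomorphic_on_diff F holomorphic_intros) auto
    show "(0::complex) islimpt (\<lambda>r. 2 * a * complex_of_real r) ` UNIV"
      using islimpt_isCont_image[of 0 UNIV "\<lambda>r. 2 * a * complex_of_real r"]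
      by (simp add: eventually_at_filter islimpt_UNIV)
    fix z assume "z \<in> (\<lambda>r. 2 * a * complex_of_real r) ` UNIV"
    then obtain r where z: "z = 2 * a * of_real r" by auto
    have "?F z = (\<integral>t. exp (a * (of_real r)\<^sup>2) * exp (- a * (complex_of_real (- r + 1 * t))\<^sup>2) \<partial>lborel)"
      by (rule Bochner_Integration.integral_cong)
        (auto simp: z exp_add[symmetric] power2_eq_square algebra_simps)
    also have "\<dots> = exp (a * (of_real r)\<^sup>2) * (\<integral>t. exp (- a * (complex_of_real t)\<^sup>2) \<partial>lborel)"
      by (subst (2) lborel_integral_real_affine[where c = 1 and t = "- r"]) auto
    also have "\<dots> = ?G z"
      unfolding complex_gaussian_integral_centered[OF a] by (simp add: z power2_eq_square mult_ac)
    finally show "?F z - ?G z = 0" by simp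
  qed auto
  then show ?thesis by simp
qed

subsection \<open>Elimination of one variable\<close>

text \<open>Without a factor 1/2 on the quadratic form: for symmetric \<open>A\<close> the critical
  point solves 2Av = b, and the critical value is half the pairing of b with v.\<close>

definition gaussian_exponent :: "'i set \<Rightarrow> ('i \<Rightarrow> 'i \<Rightarrow> complex) \<Rightarrow> ('i \<Rightarrow> complex) \<Rightarrow> ('i \<Rightarrow> complex) \<Rightarrow> complex" where
  "gaussian_exponent I A b w = (\<Sum>i\<in>I. b i * w i) - (\<Sum>i\<in>I. w i * (\<Sum>j\<in>I. A i j * w j))"

definition gaussian_integral :: "'i set \<Rightarrow> ('i \<Rightarrow> 'i \<Rightarrow> complex) \<Rightarrow> ('i \<Rightarrow> complex) \<Rightarrow> complex" where
  "gaussian_integral I A b =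
    (\<integral>w. exp (gaussian_exponent I A b (\<lambda>i. complex_of_real (w i))) \<partial>(\<Pi>\<^sub>M i\<in>I. lborel))"

text \<open>For symmetric \<open>A\<close> this is positive definiteness of the real part. The form
  is taken on complex vectors because eliminating a variable through a complex pivot turns real
  vectors into complex ones.\<close>

definition coercive_on :: "'i set \<Rightarrow> ('i \<Rightarrow> 'i \<Rightarrow> complex) \<Rightarrow> bool" where
  "coercive_on I A \<longleftrightarrow> (\<exists>\<delta>>0. \<forall>w. \<delta> * (\<Sum>i\<in>I. (cmod (w i))\<^sup>2)
     \<le> Re (\<Sum>i\<in>I. cnj (w i) * (\<Sum>j\<in>I. A i j * w j)))"

text \<open>Coercivity bounds the modulus of the integrand by a product of one-dimensional
  Gaussians.\<close>

lemma integrable_gaussian: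
  assumes "finite I" "coercive_on I A"
  shows "integrable (\<Pi>\<^sub>M i\<in>I. lborel)
    (\<lambda>w. exp (gaussian_exponent I A b (\<lambda>i. complex_of_real (w i))))"
proof -
  interpret product_sigma_finite "\<lambda>_::'a. lborel :: real measure" by standard
  obtain \<delta> where \<delta>: "\<delta> > 0" and
    le: "\<And>w. \<delta> * (\<Sum>i\<in>I. (cmod (w i))\<^sup>2) \<le> Re (\<Sum>i\<in>I. cnj (w i) * (\<Sum>j\<in>I. A i j * w j))"
    using assms(2) unfolding coercive_on_def by blast
  show ?thesis
  proof (rule Bochner_Integration.integrable_bound)
    show "integrable (\<Pi>\<^sub>M i\<in>I. lborel) (\<lambda>w. \<Prod>i\<in>I. exp (- \<delta> * (w i)\<^sup>2 + Re (b i) * w i))"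
      using assms(1) gaussian_linear_integrable[OF \<delta>] by (intro product_integrable_prod) auto
    show "(\<lambda>w. exp (gaussian_exponent I A b (\<lambda>i. complex_of_real (w i))))
      \<in> borel_measurable (\<Pi>\<^sub>M i\<in>I. lborel)"
      unfolding gaussian_exponent_def by measurable
    have "norm (exp (gaussian_exponent I A b (\<lambda>i. complex_of_real (w i))))
      \<le> norm (\<Prod>i\<in>I. exp (- \<delta> * (w i)\<^sup>2 + Re (b i) * w i))" for w
    proof -
      have "norm (exp (gaussian_exponent I A b (\<lambda>i. complex_of_real (w i))))
        \<le> exp (\<Sum>i\<in>I. - \<delta> * (w i)\<^sup>2 + Re (b i) * w i)"
        using le[of "\<lambda>i. complex_of_real (w i)"]
        by (simp add: gaussian_exponent_def sum_subtractf sum_distrib_left)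
      then show ?thesis
        using assms(1) by (simp add: exp_sum prod_nonneg)
    qed
    then show "AE w in (\<Pi>\<^sub>M i\<in>I. lborel). norm (exp (gaussian_exponent I A b (\<lambda>i. complex_of_real (w i))))
      \<le> norm (\<Prod>i\<in>I. exp (- \<delta> * (w i)\<^sup>2 + Re (b i) * w i))" by simp
  qed
qed

lemma coercive_on_diag:
  assumes "finite I" "coercive_on I A" "k \<in> I"
  shows "0 < Re (A k k)"
proof -
  obtain \<delta> where \<delta>: "\<delta> > 0" and
    le: "\<And>w. \<delta> * (\<Sum>i\<in>I. (cmod (w i))\<^sup>2) \<le> Re (\<Sum>i\<in>I. cnj (w i) * (\<Sum>j\<in>I. A i j * w j))"
    using assms(2) unfolding coercive_on_def by blast
  have "(\<Sum>i\<in>I. (cmod (if i = k then 1 else 0))\<^sup>2) = 1"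
    using assms by (subst sum.mono_neutral_right[of _ "{k}"]) auto
  then show ?thesis
    using le[of "\<lambda>i. if i = k then 1 else 0"] \<delta> assms
    by (simp add: if_distrib[where f = "\<lambda>x. _ * x"] if_distrib[where f = cnj]
        if_distrib[where f = "\<lambda>x. x * _"] cong: if_cong)
qed

definition schur :: "'i \<Rightarrow> ('i \<Rightarrow> 'i \<Rightarrow> complex) \<Rightarrow> 'i \<Rightarrow> 'i \<Rightarrow> complex" where
  "schur k A = (\<lambda>i j. A i j - A i k * A k j / A k k)"

text \<open>Row \<open>k\<close>, with right-hand side \<open>c\<close>, is used to eliminate
  \<open>w k\<close> from row \<open>i\<close>. The value c = 0 serves coercivity and kernels, c =
  \<open>b k / 2\<close> the critical point equation.\<close>

lemma schur_mult:
  assumes "finite I" "k \<notin> I" "A k k \<noteq> 0"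
    and "A k k * w k + (\<Sum>j\<in>I. A k j * w j) = c"
  shows "(\<Sum>j\<in>I. schur k A i j * w j) = (\<Sum>j\<in>insert k I. A i j * w j) - A i k * c / A k k"
proof -
  have "(\<Sum>j\<in>I. schur k A i j * w j) = (\<Sum>j\<in>I. A i j * w j) - A i k * (\<Sum>j\<in>I. A k j * w j) / A k k"
    by (simp add: schur_def algebra_simps sum_subtractf sum_distrib_left sum_divide_distrib)
  also have "(\<Sum>j\<in>I. A k j * w j) = c - A k k * w k" using assms(4) by (simp add: algebra_simps)
  finally show ?thesis using assms(1-3) by (simp add: field_simps)
qed

text \<open>Extend \<open>w\<close> by the entry that makes row \<open>k\<close> vanish. The
  Hermitian form of \<open>A\<close> at the extension is that of the Schur complement at
  \<open>w\<close>, and the extension is no shorter than \<open>w\<close>, so the same \<delta>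
  works.\<close>

lemma coercive_on_schur:
  assumes "finite I" "k \<notin> I" "coercive_on (insert k I) A"
  shows "coercive_on I (schur k A)"
proof -
  have a: "A k k \<noteq> 0" using coercive_on_diag[OF _ assms(3), of k] assms(1) by auto
  obtain \<delta> where \<delta>: "\<delta> > 0" and
    le: "\<And>w. \<delta> * (\<Sum>i\<in>insert k I. (cmod (w i))\<^sup>2)
      \<le> Re (\<Sum>i\<in>insert k I. cnj (w i) * (\<Sum>j\<in>insert k I. A i j * w j))"
    using assms(3) unfolding coercive_on_def by blast
  have "\<delta> * (\<Sum>i\<in>I. (cmod (w i))\<^sup>2) \<le> Re (\<Sum>i\<in>I. cnj (w i) * (\<Sum>j\<in>I. schur k A i j * w j))" for w
  proof -
    define u where "u = w(k := - (\<Sum>j\<in>I. A k j * w j) / A k k)"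
    have uw: "u j = w j" if "j \<in> I" for j using that assms(2) by (auto simp: u_def)
    have u0: "A k k * u k + (\<Sum>j\<in>I. A k j * u j) = 0"
      using a by (simp add: uw cong: sum.cong) (simp add: u_def)
    have "\<delta> * (\<Sum>i\<in>I. (cmod (w i))\<^sup>2) \<le> \<delta> * (\<Sum>i\<in>insert k I. (cmod (u i))\<^sup>2)"
      using \<delta> assms(1,2) by (simp add: uw cong: sum.cong)
    also have "\<dots> \<le> Re (\<Sum>i\<in>insert k I. cnj (u i) * (\<Sum>j\<in>insert k I. A i j * u j))" by (rule le)
    also have "(\<Sum>i\<in>insert k I. cnj (u i) * (\<Sum>j\<in>insert k I. A i j * u j))
      = (\<Sum>i\<in>I. cnj (u i) * (\<Sum>j\<in>insert k I. A i j * u j))"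
      using u0 assms(1,2) by simp
    also have "\<dots> = (\<Sum>i\<in>I. cnj (u i) * (\<Sum>j\<in>I. schur k A i j * u j))"
      using schur_mult[of I k A u 0] assms a u0 by simp
    finally show ?thesis by (simp add: uw cong: sum.cong)
  qed
  then show ?thesis using \<delta> unfolding coercive_on_def by blast
qed

text \<open>The first part isolates the dependence on variable \<open>k\<close>, a quadratic in
  \<open>t\<close> with linear coefficient \<open>\<beta> w\<close>. The second rewrites the
  exponent left after integrating over \<open>t\<close>, which is again of Gaussian form.\<close>

lemma gaussian_exponent_schur:
  fixes A :: "'i \<Rightarrow> 'i \<Rightarrow> complex" and b :: "'i \<Rightarrow> complex"
  assumes "finite I" "k \<notin> I" "A k k \<noteq> 0" and sym: "\<forall>j\<in>I. A j k = A k j"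
  defines "\<beta> \<equiv> \<lambda>w. b k - 2 * (\<Sum>j\<in>I. A k j * w j)"
  shows "gaussian_exponent (insert k I) A b (w(k := t))
      = (- A k k * t\<^sup>2 + \<beta> w * t) + gaussian_exponent I A b w"
    and "(\<beta> w)\<^sup>2 / (4 * A k k) + gaussian_exponent I A b w
      = (b k)\<^sup>2 / (4 * A k k) + gaussian_exponent I (schur k A) (\<lambda>i. b i - A i k * b k / A k k) w"
proof -
  have upd: "(w(k := t)) j = w j" if "j \<in> I" for j using that assms(2) by auto
  let ?c = "\<Sum>j\<in>I. A k j * w j"
  have c: "(\<Sum>i\<in>I. w i * A i k) = ?c"
    by (rule sum.cong) (auto simp: sym)
  have "(\<Sum>i\<in>I. w i * (A i k * t + (\<Sum>j\<in>I. A i j * w j)))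
      = ?c * t + (\<Sum>i\<in>I. w i * (\<Sum>j\<in>I. A i j * w j))"
    unfolding c[symmetric] by (simp add: algebra_simps sum.distrib sum_distrib_left)
  then show "gaussian_exponent (insert k I) A b (w(k := t))
      = (- A k k * t\<^sup>2 + \<beta> w * t) + gaussian_exponent I A b w"
    using assms(1,2)
    by (simp add: gaussian_exponent_def upd \<beta>_def algebra_simps power2_eq_square
        del: fun_upd_apply cong: sum.cong) (simp add: algebra_simps)
  have "(\<Sum>j\<in>I. schur k A i j * w j) = (\<Sum>j\<in>I. A i j * w j) - A i k * ?c / A k k" for i
    by (simp add: schur_def algebra_simps sum_subtractf sum_distrib_left sum_divide_distrib)
  moreover have "(\<Sum>i\<in>I. w i * (R i - A i k * d / A k k))
      = (\<Sum>i\<in>I. w i * R i) - (\<Sum>i\<in>I. w i * A i k) * d / A k k" for R d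
    by (simp add: right_diff_distrib sum_subtractf sum_distrib_right sum_divide_distrib mult.assoc)
  ultimately have 1: "(\<Sum>i\<in>I. w i * (\<Sum>j\<in>I. schur k A i j * w j))
      = (\<Sum>i\<in>I. w i * (\<Sum>j\<in>I. A i j * w j)) - ?c * ?c / A k k"
    by (simp only: c)
  have 2: "(\<Sum>i\<in>I. (b i - A i k * b k / A k k) * w i) = (\<Sum>i\<in>I. b i * w i) - ?c * b k / A k k"
  proof -
    have "(\<Sum>i\<in>I. (b i - A i k * d / A k k) * w i)
      = (\<Sum>i\<in>I. b i * w i) - (\<Sum>i\<in>I. w i * A i k) * d / A k k" for d
      by (simp add: left_diff_distrib sum_subtractf)
        (simp add: sum_distrib_left sum_distrib_right sum_divide_distrib mult_ac)
    then show ?thesis by (simp only: c)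
  qed
  show "(\<beta> w)\<^sup>2 / (4 * A k k) + gaussian_exponent I A b w
      = (b k)\<^sup>2 / (4 * A k k) + gaussian_exponent I (schur k A) (\<lambda>i. b i - A i k * b k / A k k) w"
    unfolding gaussian_exponent_def 1 2 \<beta>_def using assms(3)
    by (simp add: field_simps power2_eq_square)
qed

text \<open>Fubini with variable \<open>k\<close> innermost; coercivity gives the pivot a positive
  real part, so the one-dimensional formula applies.\<close>

lemma gaussian_integral_schur:
  fixes A :: "'i \<Rightarrow> 'i \<Rightarrow> complex"
  assumes "finite I" "k \<notin> I" "coercive_on (insert k I) A" and sym: "\<forall>j\<in>I. A j k = A k j"
  shows "gaussian_integral (insert k I) A b = csqrt (pi / A k k) * exp ((b k)\<^sup>2 / (4 * A k k))
    * gaussian_integral I (schur k A) (\<lambda>i. b i - A i k * b k / A k k)"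
proof -
  interpret product_sigma_finite "\<lambda>_::'i. lborel :: real measure" by standard
  have a: "0 < Re (A k k)" using coercive_on_diag[OF _ assms(3), of k] assms(1) by auto
  then have a0: "A k k \<noteq> 0" by auto
  let ?b = "\<lambda>i. b i - A i k * b k / A k k"
  have upd: "(\<lambda>i. complex_of_real ((w(k := t)) i)) = (\<lambda>i. complex_of_real (w i))(k := complex_of_real t)"
    for w t by auto
  have "gaussian_integral (insert k I) A b
    = (\<integral>w. (\<integral>t. exp (gaussian_exponent (insert k I) A b (\<lambda>i. complex_of_real ((w(k := t)) i))) \<partial>lborel)
        \<partial>(\<Pi>\<^sub>M i\<in>I. lborel))"
    unfolding gaussian_integral_def using assms
    by (intro product_integral_insert integrable_gaussian) auto
  also have "\<dots> = (\<integral>w. csqrt (pi / A k k) * exp ((b k)\<^sup>2 / (4 * A k k))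
      * exp (gaussian_exponent I (schur k A) ?b (\<lambda>i. complex_of_real (w i))) \<partial>(\<Pi>\<^sub>M i\<in>I. lborel))"
  proof (rule Bochner_Integration.integral_cong[OF refl])
    fix w :: "'i \<Rightarrow> real"
    let ?w = "\<lambda>i. complex_of_real (w i)"
    let ?\<beta> = "b k - 2 * (\<Sum>j\<in>I. A k j * ?w j)"
    have "(\<integral>t. exp (gaussian_exponent (insert k I) A b (\<lambda>i. complex_of_real ((w(k := t)) i))) \<partial>lborel)
      = (\<integral>t. exp (- A k k * (complex_of_real t)\<^sup>2 + ?\<beta> * complex_of_real t)
          * exp (gaussian_exponent I A b ?w) \<partial>lborel)"
      unfolding upd gaussian_exponent_schur(1)[where A = A, OF assms(1,2) a0 sym] by (simp only: exp_add)
    also have "\<dots> = csqrt (pi / A k k) * exp (?\<beta>\<^sup>2 / (4 * A k k)) * exp (gaussian_exponent I A b ?w)"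
      unfolding integral_mult_left_zero complex_gaussian_integral[OF a] ..
    also have "\<dots> = csqrt (pi / A k k) * exp ((b k)\<^sup>2 / (4 * A k k))
      * exp (gaussian_exponent I (schur k A) ?b ?w)"
      unfolding mult.assoc exp_add[symmetric] gaussian_exponent_schur(2)[where A = A and b = b and w = ?w, OF assms(1,2) a0 sym] ..
    finally show "(\<integral>t. exp (gaussian_exponent (insert k I) A b (\<lambda>i. complex_of_real ((w(k := t)) i))) \<partial>lborel)
      = csqrt (pi / A k k) * exp ((b k)\<^sup>2 / (4 * A k k)) * exp (gaussian_exponent I (schur k A) ?b ?w)" .
  qed
  also have "\<dots> = csqrt (pi / A k k) * exp ((b k)\<^sup>2 / (4 * A k k)) * gaussian_integral I (schur k A) ?b"
    unfolding gaussian_integral_def by (rule integral_mult_right_zero)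
  finally show ?thesis .
qed

subsection \<open>Limits of Gaussian integrals\<close>

text \<open>The substitution \<open>w\<^sub>j \<mapsto> w\<^sub>j + w\<^sub>k\<close> creates a nonzero diagonal entry when the limiting matrix
  has zero diagonal and therefore offers no pivot for the Schur complement.\<close>

definition shear :: "'i \<Rightarrow> 'i \<Rightarrow> ('i \<Rightarrow> 'a::plus) \<Rightarrow> 'i \<Rightarrow> 'a" where
  "shear j k w = w(j := w j + w k)"

text \<open>With S = I + E_jk the matrix of \<open>shear j k\<close>, this is S^T A S;
  \<open>shear_vec\<close> is S^T b.\<close>

definition shear_mat :: "'i \<Rightarrow> 'i \<Rightarrow> ('i \<Rightarrow> 'i \<Rightarrow> complex) \<Rightarrow> 'i \<Rightarrow> 'i \<Rightarrow> complex" where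
  "shear_mat j k A = (\<lambda>p q. A p q + (if p = k then A j q else 0)
     + (if q = k then A p j + (if p = k then A j j else 0) else 0))"

definition shear_vec :: "'i \<Rightarrow> 'i \<Rightarrow> ('i \<Rightarrow> complex) \<Rightarrow> 'i \<Rightarrow> complex" where
  "shear_vec j k b = (\<lambda>p. b p + (if p = k then b j else 0))"

lemma sum_shear:
  fixes f w :: "'i \<Rightarrow> complex"
  assumes "finite I" "j \<in> I"
  shows "(\<Sum>p\<in>I. f p * shear j k w p) = (\<Sum>p\<in>I. f p * w p) + f j * w k"
proof -
  have "f p * shear j k w p = f p * w p + (if p = j then f j * w k else 0)" for p
    by (simp add: shear_def algebra_simps)
  then show ?thesis using assms by (simp add: sum.distrib)
qed

lemma sum_shear_vec:
  assumes "finite I" "j \<in> I" "k \<in> I"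
  shows "(\<Sum>p\<in>I. shear_vec j k b p * w p) = (\<Sum>p\<in>I. b p * shear j k w p)"
proof -
  have "shear_vec j k b p * w p = b p * w p + (if p = k then b j * w k else 0)" for p
    by (simp add: shear_vec_def algebra_simps)
  then show ?thesis using assms by (simp add: sum.distrib sum_shear)
qed

lemma shear_mat_mult:
  assumes "finite I" "j \<in> I" "k \<in> I"
  shows "(\<Sum>q\<in>I. shear_mat j k A p q * w q) = shear_vec j k (\<lambda>p. \<Sum>q\<in>I. A p q * shear j k w q) p"
proof -
  have "shear_mat j k A p q * w q = A p q * w q + (if p = k then A j q * w q else 0)
    + (if q = k then (A p j + (if p = k then A j j else 0)) * w k else 0)" for q
    by (simp add: shear_mat_def algebra_simps)
  then show ?thesis
    using assms by (simp add: sum.distrib sum_shear shear_vec_def algebra_simps)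
qed

lemma gaussian_exponent_shear:
  assumes "finite I" "j \<in> I" "k \<in> I"
  shows "gaussian_exponent I (shear_mat j k A) (shear_vec j k b) w
    = gaussian_exponent I A b (shear j k w)"
proof -
  have "(\<Sum>i\<in>I. w i * (\<Sum>q\<in>I. shear_mat j k A i q * w q))
    = (\<Sum>i\<in>I. shear_vec j k (\<lambda>p. \<Sum>q\<in>I. A p q * shear j k w q) i * w i)"
    unfolding shear_mat_mult[OF assms] by (intro sum.cong refl mult.commute)
  then show ?thesis
    unfolding gaussian_exponent_def sum_shear_vec[OF assms]
    by (simp add: mult.commute[of "shear j k w _"])
qed

lemma coercive_on_shear:
  assumes "finite I" "j \<in> I" "k \<in> I" "j \<noteq> k" "coercive_on I A"
  shows "coercive_on I (shear_mat j k A)"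
proof -
  obtain \<delta> where \<delta>: "\<delta> > 0" and
    le: "\<And>w. \<delta> * (\<Sum>i\<in>I. (cmod (w i))\<^sup>2) \<le> Re (\<Sum>i\<in>I. cnj (w i) * (\<Sum>j\<in>I. A i j * w j))"
    using assms(5) unfolding coercive_on_def by blast
  \<comment> \<open>The factor 3: with s the sheared vector, w_j = s_j - w_k gives |w_j|^2 \<le>
    2|s_j|^2 + 2|w_k|^2, and |w_k|^2 = |s_k|^2 occurs once more on its own.\<close>
  have "\<delta> / 3 * (\<Sum>i\<in>I. (cmod (w i))\<^sup>2) \<le> Re (\<Sum>i\<in>I. cnj (w i) * (\<Sum>q\<in>I. shear_mat j k A i q * w q))" for w
  proof -
    let ?s = "shear j k w"
    have split: "(\<Sum>i\<in>I. g i) = (\<Sum>i\<in>I - {j,k}. g i) + g j + g k" for g :: "'a \<Rightarrow> real"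
      using assms(1-4) by (subst sum.subset_diff[of "{j,k}"]) auto
    have "cmod (w j) \<le> cmod (?s j) + cmod (w k)"
      using norm_triangle_ineq4[of "?s j" "w k"] by (simp add: shear_def)
    then have "(cmod (w j))\<^sup>2 \<le> (cmod (?s j) + cmod (w k))\<^sup>2"
      by (intro power_mono) auto
    also have "\<dots> \<le> 2 * (cmod (?s j))\<^sup>2 + 2 * (cmod (w k))\<^sup>2"
      using sum_squares_bound[of "cmod (?s j)" "cmod (w k)"] by (simp add: power2_sum)
    finally have "(cmod (w j))\<^sup>2 \<le> 2 * (cmod (?s j))\<^sup>2 + 2 * (cmod (w k))\<^sup>2" .
    moreover have "(\<Sum>i\<in>I - {j,k}. (cmod (?s i))\<^sup>2) = (\<Sum>i\<in>I - {j,k}. (cmod (w i))\<^sup>2)"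
      by (rule sum.cong) (auto simp: shear_def)
    moreover have "0 \<le> (\<Sum>i\<in>I - {j,k}. (cmod (w i))\<^sup>2)" by (rule sum_nonneg) simp
    moreover have "(cmod (?s k))\<^sup>2 = (cmod (w k))\<^sup>2" using assms(4) by (simp add: shear_def)
    ultimately have "(\<Sum>i\<in>I. (cmod (w i))\<^sup>2) \<le> 3 * (\<Sum>i\<in>I. (cmod (?s i))\<^sup>2)"
      unfolding split using zero_le_power2[of "cmod (?s j)"] by (smt (verit))
    then have "\<delta> / 3 * (\<Sum>i\<in>I. (cmod (w i))\<^sup>2) \<le> \<delta> * (\<Sum>i\<in>I. (cmod (?s i))\<^sup>2)"
      using \<delta> by simp
    also have "\<dots> \<le> Re (\<Sum>i\<in>I. cnj (?s i) * (\<Sum>j\<in>I. A i j * ?s j))" by (rule le)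
    \<comment> \<open>The shear has real coefficients and hence commutes with conjugation.\<close>
    also have "(\<Sum>i\<in>I. cnj (?s i) * (\<Sum>j\<in>I. A i j * ?s j))
      = (\<Sum>i\<in>I. (\<Sum>j\<in>I. A i j * ?s j) * shear j k (\<lambda>i. cnj (w i)) i)"
      by (intro sum.cong) (auto simp: shear_def)
    also have "\<dots> = (\<Sum>i\<in>I. cnj (w i) * (\<Sum>q\<in>I. shear_mat j k A i q * w q))"
      unfolding shear_mat_mult[OF assms(1-3)] sum_shear_vec[OF assms(1-3), symmetric]
      by (simp add: mult.commute)
    finally show ?thesis .
  qed
  then show ?thesis using \<delta> unfolding coercive_on_def by (intro exI[of _ "\<delta> / 3"]) auto
qed

text \<open>With \<open>w k\<close> frozen, the shear is a translation of \<open>w j\<close>;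
  integrate over that variable first and use translation invariance.\<close>

lemma gaussian_integral_shear:
  fixes A :: "'i \<Rightarrow> 'i \<Rightarrow> complex"
  assumes "finite I" "j \<in> I" "k \<in> I" "j \<noteq> k" "coercive_on I A"
  shows "gaussian_integral I (shear_mat j k A) (shear_vec j k b) = gaussian_integral I A b"
proof -
  interpret product_sigma_finite "\<lambda>_::'i. lborel :: real measure" by standard
  define J where "J = I - {j}"
  have J: "I = insert j J" "finite J" "j \<notin> J" "k \<in> J"
    using assms(1-4) by (auto simp: J_def)
  have upd: "(\<lambda>i. complex_of_real ((w(j := t)) i)) = (\<lambda>i. complex_of_real (w i))(j := complex_of_real t)"
    for w t by auto
  have shear_upd: "shear j k (w(j := t)) = w(j := w k + t)" for w :: "'i \<Rightarrow> complex" and t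
    using assms(4) by (auto simp: shear_def add.commute)
  have fubini: "gaussian_integral I B c
    = (\<integral>w. (\<integral>t. exp (gaussian_exponent I B c ((\<lambda>i. complex_of_real (w i))(j := complex_of_real t))) \<partial>lborel)
        \<partial>(\<Pi>\<^sub>M i\<in>J. lborel))" if "coercive_on I B" for B c
    unfolding gaussian_integral_def upd[symmetric]
    using integrable_gaussian[OF assms(1) that] J
    by (simp only:) (intro product_integral_insert)
  have "(\<integral>t. exp (gaussian_exponent I A b ((\<lambda>i. complex_of_real (w i))(j := complex_of_real t))) \<partial>lborel)
    = (\<integral>t. exp (gaussian_exponent I A b ((\<lambda>i. complex_of_real (w i))(j := complex_of_real (w k + 1 * t)))) \<partial>lborel)"
    for w
    by (subst lborel_integral_real_affine[where c = 1 and t = "w k"]) auto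
  then show ?thesis
    unfolding fubini[OF assms(5)] fubini[OF coercive_on_shear[OF assms]]
      gaussian_exponent_shear[OF assms(1-3)] shear_upd by simp
qed

text \<open>The coercivity constant may depend on \<open>e\<close> and degenerate along
  \<open>F\<close>, so the limit keeps only a semidefinite real part; its invertibility is therefore
  required separately, as triviality of the kernel.\<close>

definition gaussian_family :: "'e filter \<Rightarrow> 'i set \<Rightarrow> ('e \<Rightarrow> 'i \<Rightarrow> 'i \<Rightarrow> complex) \<Rightarrow> ('i \<Rightarrow> 'i \<Rightarrow> complex) \<Rightarrow> bool" where
  "gaussian_family F I A A0 \<longleftrightarrow>
     (\<forall>\<^sub>F e in F. coercive_on I (A e) \<and> (\<forall>i\<in>I. \<forall>j\<in>I. A e i j = A e j i)) \<and>
     (\<forall>i\<in>I. \<forall>j\<in>I. ((\<lambda>e. A e i j) \<longlongrightarrow> A0 i j) F) \<and>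
     (\<forall>v. (\<forall>i\<in>I. (\<Sum>j\<in>I. A0 i j * v j) = 0) \<longrightarrow> (\<forall>i\<in>I. v i = 0))"

text \<open>The vector \<open>v\<close> is the critical point of the limiting exponent and the exponential is its
  critical value; the constant \<open>C\<close> stands for \<open>(\<pi>\<^sup>n / det A0)\<^sup>1\<^sup>/\<^sup>2\<close> with the branch
  obtained by continuation, and neither the determinant nor the branch is needed.\<close>

definition gaussian_limit :: "'e filter \<Rightarrow> 'i set \<Rightarrow> ('e \<Rightarrow> 'i \<Rightarrow> 'i \<Rightarrow> complex) \<Rightarrow> ('i \<Rightarrow> 'i \<Rightarrow> complex) \<Rightarrow> bool" where
  "gaussian_limit F I A A0 \<longleftrightarrow> (\<exists>C. \<forall>B b. (\<forall>i\<in>I. ((\<lambda>e. B e i) \<longlongrightarrow> b i) F) \<longrightarrow>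
     (\<exists>v. (\<forall>i\<in>I. 2 * (\<Sum>j\<in>I. A0 i j * v j) = b i) \<and>
       ((\<lambda>e. gaussian_integral I (A e) (B e)) \<longlongrightarrow> C * exp ((\<Sum>i\<in>I. b i * v i) / 2)) F))"

section \<open>Reduction of the limit to fewer variables\<close>

lemma gaussian_family_symD:
  assumes "gaussian_family F I A A0" "F \<noteq> bot" "i \<in> I" "j \<in> I"
  shows "A0 i j = A0 j i"
proof (rule tendsto_unique[OF assms(2)])
  show "((\<lambda>e. A e i j) \<longlongrightarrow> A0 i j) F" using assms by (auto simp: gaussian_family_def)
  have "((\<lambda>e. A e j i) \<longlongrightarrow> A0 j i) F" using assms by (auto simp: gaussian_family_def)
  moreover have "\<forall>\<^sub>F e in F. A e j i = A e i j"
    using assms unfolding gaussian_family_def by (auto elim!: eventually_mono)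
  ultimately show "((\<lambda>e. A e i j) \<longlongrightarrow> A0 j i) F" by (rule Lim_transform_eventually)
qed

text \<open>The integrals agree before and after the shear S, and a critical point v of the sheared
  problem gives S v for the original one with the same critical value, since S^T b paired with v is
  b paired with S v.\<close>

lemma gaussian_limit_shear:
  assumes "finite I" "F \<noteq> bot" "j \<in> I" "k \<in> I" "j \<noteq> k" and fam: "gaussian_family F I A A0"
    and IH: "gaussian_family F I (\<lambda>e. shear_mat j k (A e)) (shear_mat j k A0)
      \<Longrightarrow> gaussian_limit F I (\<lambda>e. shear_mat j k (A e)) (shear_mat j k A0)"
  shows "gaussian_limit F I A A0"
proof -
  have ev: "\<forall>\<^sub>F e in F. coercive_on I (A e) \<and> (\<forall>i\<in>I. \<forall>j\<in>I. A e i j = A e j i)"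
    and conv: "\<And>p q. p \<in> I \<Longrightarrow> q \<in> I \<Longrightarrow> ((\<lambda>e. A e p q) \<longlongrightarrow> A0 p q) F"
    and inj: "\<And>v. \<forall>i\<in>I. (\<Sum>j\<in>I. A0 i j * v j) = 0 \<Longrightarrow> \<forall>i\<in>I. v i = 0"
    using fam unfolding gaussian_family_def by blast+
  \<comment> \<open>S^T is injective: it changes entry \<open>k\<close> only, by adding entry
    \<open>j\<close>, which is itself unchanged because \<open>j \<noteq> k\<close>.\<close>
  have unshear: "\<forall>p\<in>I. r p = s p" if "\<forall>p\<in>I. shear_vec j k r p = shear_vec j k s p" for r s
  proof -
    have ne: "r p = s p" if "p \<in> I" "p \<noteq> k" for p
      using \<open>\<forall>p\<in>I. shear_vec j k r p = shear_vec j k s p\<close>[rule_format, OF that(1)] that(2)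
      by (simp add: shear_vec_def)
    then have "r j = s j" using assms(3,5) by blast
    then have "r k = s k" using that assms(4) by (auto simp: shear_vec_def)
    then show ?thesis using ne by metis
  qed
  have "gaussian_limit F I (\<lambda>e. shear_mat j k (A e)) (shear_mat j k A0)"
  proof (rule IH, unfold gaussian_family_def, intro conjI ballI allI impI)
    show "\<forall>\<^sub>F e in F. coercive_on I (shear_mat j k (A e))
        \<and> (\<forall>p\<in>I. \<forall>q\<in>I. shear_mat j k (A e) p q = shear_mat j k (A e) q p)"
      using ev
    proof eventually_elim
      case (elim e)
      moreover have "shear_mat j k (A e) p q = shear_mat j k (A e) q p" if "p \<in> I" "q \<in> I" for p q
        using elim that assms(3,4) by (auto simp: shear_mat_def)
      ultimately show ?case using coercive_on_shear[OF assms(1,3-5)] by blast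
    qed
  next
    fix p q assume "p \<in> I" "q \<in> I"
    then show "((\<lambda>e. shear_mat j k (A e) p q) \<longlongrightarrow> shear_mat j k A0 p q) F"
      unfolding shear_mat_def using assms(3,4)
      by (cases "p = k"; cases "q = k") (auto intro!: tendsto_intros conv)
  next
    fix v i assume 0: "\<forall>i\<in>I. (\<Sum>q\<in>I. shear_mat j k A0 i q * v q) = 0" and i: "i \<in> I"
    have "\<forall>p\<in>I. (\<Sum>q\<in>I. A0 p q * shear j k v q) = 0"
      using 0 unshear[of "\<lambda>p. \<Sum>q\<in>I. A0 p q * shear j k v q" "\<lambda>_. 0"]
      by (simp add: shear_mat_mult[OF assms(1,3,4)]) (simp add: shear_vec_def)
    then have z: "\<forall>i\<in>I. shear j k v i = 0" by (rule inj)
    then have "v k = 0" using assms(4,5) by (auto simp: shear_def dest!: bspec[of _ _ k])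
    then show "v i = 0" using z[rule_format, OF i] by (auto simp: shear_def split: if_splits)
  qed
  then obtain C where C: "\<And>B b. \<forall>i\<in>I. ((\<lambda>e. B e i) \<longlongrightarrow> b i) F \<Longrightarrow>
     \<exists>v. (\<forall>i\<in>I. 2 * (\<Sum>q\<in>I. shear_mat j k A0 i q * v q) = b i) \<and>
       ((\<lambda>e. gaussian_integral I (shear_mat j k (A e)) (B e)) \<longlongrightarrow> C * exp ((\<Sum>i\<in>I. b i * v i) / 2)) F"
    unfolding gaussian_limit_def by blast
  show ?thesis
    unfolding gaussian_limit_def
  proof (intro exI[of _ C] allI impI)
    fix B b assume B: "\<forall>i\<in>I. ((\<lambda>e. B e i) \<longlongrightarrow> (b i :: complex)) F"
    have "\<forall>i\<in>I. ((\<lambda>e. shear_vec j k (B e) i) \<longlongrightarrow> shear_vec j k b i) F"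
      using B assms(3,4) unfolding shear_vec_def by (auto intro!: tendsto_intros)
    from C[OF this] obtain v where
      v: "\<forall>i\<in>I. 2 * (\<Sum>q\<in>I. shear_mat j k A0 i q * v q) = shear_vec j k b i" and
      lim: "((\<lambda>e. gaussian_integral I (shear_mat j k (A e)) (shear_vec j k (B e)))
        \<longlongrightarrow> C * exp ((\<Sum>i\<in>I. shear_vec j k b i * v i) / 2)) F" by blast
    show "\<exists>v. (\<forall>i\<in>I. 2 * (\<Sum>j\<in>I. A0 i j * v j) = b i) \<and>
       ((\<lambda>e. gaussian_integral I (A e) (B e)) \<longlongrightarrow> C * exp ((\<Sum>i\<in>I. b i * v i) / 2)) F"
    proof (intro exI[of _ "shear j k v"] conjI)
      have "\<forall>p\<in>I. shear_vec j k (\<lambda>p. 2 * (\<Sum>q\<in>I. A0 p q * shear j k v q)) p = shear_vec j k b p"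
        using v unfolding shear_mat_mult[OF assms(1,3,4)]
        by (auto simp: shear_vec_def distrib_left)
      then show "\<forall>i\<in>I. 2 * (\<Sum>q\<in>I. A0 i q * shear j k v q) = b i" by (rule unshear)
      have "\<forall>\<^sub>F e in F. gaussian_integral I (shear_mat j k (A e)) (shear_vec j k (B e))
          = gaussian_integral I (A e) (B e)"
        using ev by eventually_elim (use assms in \<open>auto intro: gaussian_integral_shear\<close>)
      from Lim_transform_eventually[OF lim this]
      show "((\<lambda>e. gaussian_integral I (A e) (B e))
          \<longlongrightarrow> C * exp ((\<Sum>i\<in>I. b i * shear j k v i) / 2)) F"
        by (simp add: sum_shear_vec[OF assms(1,3,4)])
    qed
  qed
qed

text \<open>The one-dimensional factor converges because the limiting pivot is nonzero and off the
  branch cut; the remaining integral converges by \<open>IH\<close>. The constant only gains the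
  factor \<open>csqrt (pi / A0 k k)\<close>, which does not depend on \<open>b\<close>.\<close>

lemma gaussian_limit_schur:
  assumes "finite I" "k \<notin> I" "F \<noteq> bot" and fam: "gaussian_family F (insert k I) A A0"
    and a: "A0 k k \<noteq> 0"
    and IH: "gaussian_family F I (\<lambda>e. schur k (A e)) (schur k A0)
      \<Longrightarrow> gaussian_limit F I (\<lambda>e. schur k (A e)) (schur k A0)"
  shows "gaussian_limit F (insert k I) A A0"
proof -
  have ev: "\<forall>\<^sub>F e in F. coercive_on (insert k I) (A e)
      \<and> (\<forall>i\<in>insert k I. \<forall>j\<in>insert k I. A e i j = A e j i)"
    and conv: "\<And>p q. p \<in> insert k I \<Longrightarrow> q \<in> insert k I \<Longrightarrow> ((\<lambda>e. A e p q) \<longlongrightarrow> A0 p q) F"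
    and inj: "\<And>v. \<forall>i\<in>insert k I. (\<Sum>j\<in>insert k I. A0 i j * v j) = 0 \<Longrightarrow> \<forall>i\<in>insert k I. v i = 0"
    using fam unfolding gaussian_family_def by blast+
  \<comment> \<open>The strict inequality for the pivots \<open>A e k k\<close> weakens in the
    limit; together with \<open>A0 k k \<noteq> 0\<close> the weak one is enough for continuity of
    \<open>csqrt\<close>.\<close>
  have "0 \<le> Re (A0 k k)"
  proof (rule tendsto_lowerbound[OF tendsto_Re[OF conv[of k k]] _ assms(3)])
    show "\<forall>\<^sub>F e in F. 0 \<le> Re (A e k k)"
      using ev
    proof eventually_elim
      case (elim e)
      then have "coercive_on (insert k I) (A e)" by blast
      then show ?case using coercive_on_diag[of "insert k I" "A e" k] assms(1) by simp
    qed
  qed auto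
  then have nonpos: "pi / A0 k k \<notin> \<real>\<^sub>\<le>\<^sub>0" using a by (rule pi_divide_notin_nonpos_Reals)
  have "gaussian_limit F I (\<lambda>e. schur k (A e)) (schur k A0)"
  proof (rule IH, unfold gaussian_family_def, intro conjI ballI allI impI)
    show "\<forall>\<^sub>F e in F. coercive_on I (schur k (A e))
        \<and> (\<forall>p\<in>I. \<forall>q\<in>I. schur k (A e) p q = schur k (A e) q p)"
      using ev
    proof eventually_elim
      case (elim e)
      moreover have "schur k (A e) p q = schur k (A e) q p" if "p \<in> I" "q \<in> I" for p q
      proof -
        have "A e p q = A e q p" "A e p k = A e k p" "A e q k = A e k q"
          using elim that by blast+
        then show ?thesis by (simp only: schur_def mult.commute)
      qed
      ultimately show ?case using coercive_on_schur[OF assms(1,2)] by blast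
    qed
  next
    fix p q assume "p \<in> I" "q \<in> I"
    then show "((\<lambda>e. schur k (A e) p q) \<longlongrightarrow> schur k A0 p q) F"
      unfolding schur_def using a by (auto intro!: tendsto_intros conv)
  next
    fix v i assume 0: "\<forall>i\<in>I. (\<Sum>q\<in>I. schur k A0 i q * v q) = 0" and i: "i \<in> I"
    \<comment> \<open>The extension that makes row \<open>k\<close> vanish carries the kernel of the
      Schur complement into the kernel of \<open>A0\<close>.\<close>
    define u where "u = v(k := - (\<Sum>j\<in>I. A0 k j * v j) / A0 k k)"
    have uv: "u j = v j" if "j \<in> I" for j using that assms(2) by (auto simp: u_def)
    have u0: "A0 k k * u k + (\<Sum>j\<in>I. A0 k j * u j) = 0"
      using a by (simp add: uv cong: sum.cong) (simp add: u_def)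
    have "(\<Sum>j\<in>insert k I. A0 p j * u j) = 0" if "p \<in> insert k I" for p
    proof (cases "p = k")
      case True
      then show ?thesis using u0 assms(1,2) by simp
    next
      case False
      then have "p \<in> I" using that by simp
      have "(\<Sum>q\<in>I. schur k A0 p q * u q) = (\<Sum>q\<in>I. schur k A0 p q * v q)"
        by (rule sum.cong) (auto simp: uv)
      then have "(\<Sum>q\<in>I. schur k A0 p q * u q) = 0"
        using bspec[OF 0 \<open>p \<in> I\<close>] by (rule trans)
      then show ?thesis
        unfolding schur_mult[where A = A0 and w = u and i = p, OF assms(1,2) a u0] by (simp only: mult_zero_right div_0 diff_zero)
    qed
    then have "\<forall>p\<in>insert k I. (\<Sum>j\<in>insert k I. A0 p j * u j) = 0" ..
    then have "\<forall>i\<in>insert k I. u i = 0" by (rule inj)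
    then show "v i = 0" using i uv by simp
  qed
  then obtain C where C: "\<And>B b. \<forall>i\<in>I. ((\<lambda>e. B e i) \<longlongrightarrow> b i) F \<Longrightarrow>
     \<exists>v. (\<forall>i\<in>I. 2 * (\<Sum>q\<in>I. schur k A0 i q * v q) = b i) \<and>
       ((\<lambda>e. gaussian_integral I (schur k (A e)) (B e)) \<longlongrightarrow> C * exp ((\<Sum>i\<in>I. b i * v i) / 2)) F"
    unfolding gaussian_limit_def by blast
  show ?thesis
    unfolding gaussian_limit_def
  proof (intro exI[of _ "csqrt (pi / A0 k k) * C"] allI impI)
    fix B b assume B: "\<forall>i\<in>insert k I. ((\<lambda>e. B e i) \<longlongrightarrow> (b i :: complex)) F"
    let ?B = "\<lambda>e i. B e i - A e i k * B e k / A e k k"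
    let ?b = "\<lambda>i. b i - A0 i k * b k / A0 k k"
    have "\<forall>i\<in>I. ((\<lambda>e. ?B e i) \<longlongrightarrow> ?b i) F"
      using B a by (auto intro!: tendsto_intros conv)
    from C[OF this] obtain v where
      v: "\<And>i. i \<in> I \<Longrightarrow> 2 * (\<Sum>q\<in>I. schur k A0 i q * v q) = ?b i" and
      lim: "((\<lambda>e. gaussian_integral I (schur k (A e)) (?B e))
        \<longlongrightarrow> C * exp ((\<Sum>i\<in>I. ?b i * v i) / 2)) F" by blast
    define c where "c = (\<Sum>j\<in>I. A0 k j * v j)"
    \<comment> \<open>Back substitution: the new entry solves row \<open>k\<close> of the critical
      point equation.\<close>
    define u where "u = v(k := (b k / 2 - c) / A0 k k)"
    have uv: "u j = v j" if "j \<in> I" for j using that assms(2) by (auto simp: u_def)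
    have uk: "A0 k k * u k = b k / 2 - c" using a by (simp add: u_def)
    then have u0: "A0 k k * u k + (\<Sum>j\<in>I. A0 k j * u j) = b k / 2"
      by (simp add: uv c_def cong: sum.cong)
    have sol: "2 * (\<Sum>j\<in>insert k I. A0 p j * u j) = b p" if "p \<in> insert k I" for p
    proof (cases "p = k")
      case True
      then show ?thesis using u0 assms(1,2) by (simp add: algebra_simps)
    next
      case False
      then have "p \<in> I" using that by simp
      have "(\<Sum>q\<in>I. schur k A0 p q * u q) = (\<Sum>q\<in>I. schur k A0 p q * v q)"
        by (rule sum.cong) (auto simp: uv)
      then have "(\<Sum>j\<in>insert k I. A0 p j * u j)
          = (\<Sum>q\<in>I. schur k A0 p q * v q) + A0 p k * (b k / 2) / A0 k k"
        unfolding schur_mult[where A = A0 and w = u and i = p, OF assms(1,2) a u0] by (simp only: diff_eq_eq)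
      then have "2 * (\<Sum>j\<in>insert k I. A0 p j * u j)
          = 2 * (\<Sum>q\<in>I. schur k A0 p q * v q) + A0 p k * b k / A0 k k"
        by (simp only: distrib_left) simp
      then show ?thesis by (simp only: v[OF \<open>p \<in> I\<close>] diff_add_cancel)
    qed
    have "c = (\<Sum>i\<in>I. v i * A0 i k)"
      unfolding c_def using gaussian_family_symD[OF fam assms(3)] by (intro sum.cong) auto
    then have 1: "(\<Sum>i\<in>I. ?b i * v i) = (\<Sum>i\<in>I. b i * v i) - c * b k / A0 k k"
      by (simp add: left_diff_distrib sum_subtractf)
        (simp add: sum_distrib_left sum_distrib_right sum_divide_distrib mult_ac)
    have 2: "(\<Sum>i\<in>insert k I. b i * u i) = (\<Sum>i\<in>I. b i * v i) + b k * (b k / 2 - c) / A0 k k"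
      using assms(1,2) by (simp add: uv cong: sum.cong) (simp add: u_def)
    \<comment> \<open>The exponent of the pivot factor and the critical value of the reduced problem
      add up to the full critical value.\<close>
    have val: "(b k)\<^sup>2 / (4 * A0 k k) + (\<Sum>i\<in>I. ?b i * v i) / 2 = (\<Sum>i\<in>insert k I. b i * u i) / 2"
      unfolding 1 2 using a by (simp add: field_simps power2_eq_square)
    have "((\<lambda>e. csqrt (pi / A e k k)) \<longlongrightarrow> csqrt (pi / A0 k k)) F"
    proof (rule isCont_tendsto_compose[OF continuous_at_csqrt[OF nonpos]])
      show "((\<lambda>e. complex_of_real pi / A e k k) \<longlongrightarrow> complex_of_real pi / A0 k k) F"
        using a by (intro tendsto_intros conv) auto
    qed
    moreover have "((\<lambda>e. exp ((B e k)\<^sup>2 / (4 * A e k k))) \<longlongrightarrow> exp ((b k)\<^sup>2 / (4 * A0 k k))) F"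
      using B a by (intro tendsto_intros conv) auto
    ultimately have L: "((\<lambda>e. csqrt (pi / A e k k) * exp ((B e k)\<^sup>2 / (4 * A e k k))
        * gaussian_integral I (schur k (A e)) (?B e))
      \<longlongrightarrow> csqrt (pi / A0 k k) * exp ((b k)\<^sup>2 / (4 * A0 k k)) * (C * exp ((\<Sum>i\<in>I. ?b i * v i) / 2))) F"
      by (intro tendsto_mult lim)
    have V: "csqrt (pi / A0 k k) * exp ((b k)\<^sup>2 / (4 * A0 k k)) * (C * exp ((\<Sum>i\<in>I. ?b i * v i) / 2))
      = csqrt (pi / A0 k k) * C * exp ((\<Sum>i\<in>insert k I. b i * u i) / 2)"
      unfolding val[symmetric] exp_add by simp
    have "\<forall>\<^sub>F e in F. csqrt (pi / A e k k) * exp ((B e k)\<^sup>2 / (4 * A e k k))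
        * gaussian_integral I (schur k (A e)) (?B e) = gaussian_integral (insert k I) (A e) (B e)"
      using ev
    proof eventually_elim
      case (elim e)
      then have "coercive_on (insert k I) (A e)" "\<forall>j\<in>I. A e j k = A e k j" by blast+
      from gaussian_integral_schur[OF assms(1,2) this, of "B e"] show ?case by (rule sym)
    qed
    note Lim_transform_eventually[OF L this, unfolded V]
    then show "\<exists>v. (\<forall>i\<in>insert k I. 2 * (\<Sum>j\<in>insert k I. A0 i j * v j) = b i) \<and>
       ((\<lambda>e. gaussian_integral (insert k I) (A e) (B e))
         \<longlongrightarrow> csqrt (pi / A0 k k) * C * exp ((\<Sum>i\<in>insert k I. b i * v i) / 2)) F"
      using sol by blast
  qed
qed

text \<open>Induction on the number of variables: a nonzero diagonal entry of \<open>A0\<close> is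
  eliminated, and if the diagonal is zero a shear first produces such an entry.\<close>

theorem gaussian_limit_of_family:
  fixes A :: "'e \<Rightarrow> 'i \<Rightarrow> 'i \<Rightarrow> complex"
  assumes "finite I" "F \<noteq> bot" "gaussian_family F I A A0"
  shows "gaussian_limit F I A A0"
  using assms(1,3)
proof (induction "card I" arbitrary: I A A0)
  \<comment> \<open>Over the empty index set the product measure is a unit point mass and the
    exponent is 0, so C = 1.\<close>
  case 0
  then have [simp]: "I = {}" by simp
  have "gaussian_integral {} B b = 1" for B :: "'i \<Rightarrow> 'i \<Rightarrow> complex" and b
    by (simp add: gaussian_integral_def gaussian_exponent_def PiM_empty lebesgue_integral_count_space_finite)
  then show ?case by (auto simp: gaussian_limit_def intro!: exI[of _ 1])
next
  case (Suc n)
  \<comment> \<open>Stated for an arbitrary family, as it is applied both to the given one and to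
    its sheared version on the same index set.\<close>
  have pivot: "gaussian_limit F I B B0"
    if fam: "gaussian_family F I B B0" and k: "k \<in> I" "B0 k k \<noteq> 0" for B B0 k
  proof -
    have I: "I = insert k (I - {k})" using k by blast
    have "gaussian_limit F (insert k (I - {k})) B B0"
    proof (rule gaussian_limit_schur)
      show "gaussian_limit F (I - {k}) (\<lambda>e. schur k (B e)) (schur k B0)"
        if "gaussian_family F (I - {k}) (\<lambda>e. schur k (B e)) (schur k B0)"
        using Suc.hyps(2) Suc.prems(1) k that by (intro Suc.hyps(1)) auto
    qed (use Suc.prems(1) assms(2) fam k I in auto)
    then show ?thesis using I by simp
  qed
  show ?case
  proof (cases "\<exists>k\<in>I. A0 k k \<noteq> 0")
    case True
    then show ?thesis using pivot Suc.prems(2) by blast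
  next
    case False
    obtain k where k: "k \<in> I" using Suc.hyps(2) by (metis card.empty ex_in_conv nat.distinct(1))
    \<comment> \<open>A zero column \<open>k\<close> would put the k-th unit vector into the kernel
      of \<open>A0\<close>.\<close>
    have "\<exists>j\<in>I. A0 j k \<noteq> 0"
    proof (rule ccontr)
      assume "\<not> ?thesis"
      then have zero: "\<forall>i\<in>I. (\<Sum>j\<in>I. A0 i j * (if j = k then 1 else 0)) = 0"
        using Suc.prems(1) k by (simp add: if_distrib[where f = "\<lambda>x. _ * x"] cong: if_cong)
      have "\<And>v. \<forall>i\<in>I. (\<Sum>j\<in>I. A0 i j * v j) = 0 \<Longrightarrow> \<forall>i\<in>I. v i = 0"
        using Suc.prems(2) unfolding gaussian_family_def by blast
      from this[OF zero] have "\<forall>i\<in>I. (if i = k then 1 else 0) = (0::complex)" .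
      then show False using k by auto
    qed
    then obtain j where j: "j \<in> I" "A0 j k \<noteq> 0" by blast
    then have "j \<noteq> k" using False k by auto
    \<comment> \<open>The diagonal terms vanish by assumption and the two off-diagonal ones coincide
      by symmetry.\<close>
    have "shear_mat j k A0 k k = 2 * A0 j k"
      using False j k gaussian_family_symD[OF Suc.prems(2) assms(2) j(1) k]
      by (simp add: shear_mat_def)
    then show ?thesis
      using gaussian_limit_shear[OF Suc.prems(1) assms(2) j(1) k \<open>j \<noteq> k\<close> Suc.prems(2)] pivot[OF _ k] j
      by simp
  qed
qed

subsection \<open>Reindexing the product measures\<close>

lemma finite_idx [simp]: "finite (idx N :: ('d::finite + nat) set)"
  by (simp add: idx_def)

lemma Inl_in_idx [simp]: "Inl i \<in> idx N" and Inr_in_idx [simp]: "Inr k \<in> idx N \<longleftrightarrow> k < N"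
  by (auto simp: idx_def)

lemma sum_idx:
  "(\<Sum>i\<in>idx N. f i) = (\<Sum>i\<in>UNIV. f (Inl i)) + (\<Sum>k<N. f (Inr k))" for f :: "'d::finite + nat \<Rightarrow> 'a::comm_monoid_add"
proof -
  have "(\<Sum>i\<in>idx N. f i) = (\<Sum>i\<in>range Inl. f i) + (\<Sum>i\<in>Inr ` {..<N}. f i)"
    unfolding idx_def by (rule sum.union_disjoint) auto
  then show ?thesis by (simp add: sum.reindex)
qed

text \<open>Lebesgue measure is determined by its values on boxes, whose preimages are products of
  intervals. The coordinates are indexed through \<open>Inl\<close> to match the position part of
  \<open>idx\<close>.\<close>

lemma lborel_vec_eq_distr:
  "(lborel :: (real^'d) measure)
    = distr (\<Pi>\<^sub>M k\<in>range (Inl :: 'd \<Rightarrow> 'd + nat). lborel) borel (\<lambda>f. \<chi> i. f (Inl i))"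
proof (rule lborel_eqI)
  interpret product_sigma_finite "\<lambda>_::'d + nat. lborel :: real measure" by standard
  have meas [measurable]: "(\<lambda>f. \<chi> i. f (Inl i)) \<in> borel_measurable (\<Pi>\<^sub>M k\<in>range (Inl :: 'd \<Rightarrow> 'd + nat). (lborel :: real measure))"
    by (subst borel_measurable_euclidean_space) (auto simp: Basis_vec_def inner_axis)
  fix l u :: "real^'d" assume le: "\<And>b. b \<in> Basis \<Longrightarrow> l \<bullet> b \<le> u \<bullet> b"
  have lu: "l $ i \<le> u $ i" for i using le[of "axis i 1"] by (simp add: inner_axis axis_in_Basis_iff)
  have "(\<lambda>f. \<chi> i. f (Inl i)) -` box l u \<inter> space (\<Pi>\<^sub>M k\<in>range (Inl :: 'd \<Rightarrow> 'd + nat). lborel)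
    = (\<Pi>\<^sub>E k\<in>range Inl. {l $ projl k <..< u $ projl k})"
    by (auto simp: mem_box_cart space_PiM PiE_iff)
  then have "emeasure (distr (\<Pi>\<^sub>M k\<in>range (Inl :: 'd \<Rightarrow> 'd + nat). lborel) borel (\<lambda>f. \<chi> i. f (Inl i))) (box l u)
    = emeasure (\<Pi>\<^sub>M k\<in>range (Inl :: 'd \<Rightarrow> 'd + nat). lborel)
        (\<Pi>\<^sub>E k\<in>range Inl. {l $ projl k <..< u $ projl k})"
    by (subst emeasure_distr[OF meas]) simp_all
  also have "\<dots> = (\<Prod>k\<in>range (Inl :: 'd \<Rightarrow> 'd + nat). emeasure lborel {l $ projl k <..< u $ projl k})"
    by (subst emeasure_PiM) auto
  also have "\<dots> = (\<Prod>i\<in>UNIV. ennreal (u $ i - l $ i))"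
    by (simp add: prod.reindex lu)
  also have "\<dots> = (\<Prod>b\<in>Basis. (u - l) \<bullet> b)"
  proof -
    have "Basis = range (\<lambda>i. axis i 1 :: real^'d)" by (auto simp: Basis_vec_def)
    moreover have "inj (\<lambda>i. axis i 1 :: real^'d)" by (auto simp: inj_def axis_eq_axis)
    moreover have "(\<Prod>b\<in>range (\<lambda>i. axis i 1). (u - l) \<bullet> b) = (\<Prod>i\<in>UNIV. u $ i - l $ i)"
      using calculation(2) by (subst prod.reindex) (simp_all add: inner_axis)
    ultimately have "(\<Prod>b\<in>Basis. (u - l) \<bullet> b) = (\<Prod>i\<in>UNIV. u $ i - l $ i)" by simp
    then show ?thesis by (simp add: prod_ennreal lu)
  qed
  finally show "emeasure (distr (\<Pi>\<^sub>M k\<in>range (Inl :: 'd \<Rightarrow> 'd + nat). lborel) borel (\<lambda>f. \<chi> i. f (Inl i))) (box l u)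
    = (\<Prod>b\<in>Basis. (u - l) \<bullet> b)" .
qed simp

text \<open>A finite product measure is determined by its values on rectangles. It serves to move
  the \<theta>-integral from \<open>{..<N}\<close> to the indices \<open>Inr k\<close>.\<close>

lemma PiM_reindex_distr:
  fixes h :: "'i \<Rightarrow> 'j"
  assumes "finite I" "inj_on h I"
  shows "(\<Pi>\<^sub>M k\<in>I. lborel :: real measure)
    = distr (\<Pi>\<^sub>M j\<in>h ` I. lborel) (\<Pi>\<^sub>M k\<in>I. lborel) (\<lambda>f. \<lambda>k\<in>I. f (h k))"
proof -
  interpret J: product_sigma_finite "\<lambda>_::'j. lborel :: real measure" by standard
  interpret product_sigma_finite "\<lambda>_::'i. lborel :: real measure" by standard
  have meas [measurable]: "(\<lambda>f. \<lambda>k\<in>I. f (h k)) \<in> (\<Pi>\<^sub>M j\<in>h ` I. lborel :: real measure) \<rightarrow>\<^sub>M (\<Pi>\<^sub>M k\<in>I. lborel :: real measure)"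
    by (rule measurable_restrict) simp
  show ?thesis
  proof (rule PiM_eqI[symmetric])
    fix A :: "'i \<Rightarrow> real set" assume A: "\<And>i. i \<in> I \<Longrightarrow> A i \<in> sets lborel"
    have "(\<lambda>f. \<lambda>k\<in>I. f (h k)) -` (\<Pi>\<^sub>E i\<in>I. A i) \<inter> space (\<Pi>\<^sub>M j\<in>h ` I. lborel)
      = (\<Pi>\<^sub>E j\<in>h ` I. A (the_inv_into I h j))"
      by (auto simp: space_PiM PiE_iff the_inv_into_f_f[OF assms(2)])
    moreover have "(\<Pi>\<^sub>E i\<in>I. A i) \<in> sets (\<Pi>\<^sub>M k\<in>I. (lborel :: real measure))"
      using A assms(1) by (intro sets_PiM_I_finite) auto
    ultimately have "emeasure (distr (\<Pi>\<^sub>M j\<in>h ` I. lborel) (\<Pi>\<^sub>M k\<in>I. lborel) (\<lambda>f. \<lambda>k\<in>I. f (h k))) (\<Pi>\<^sub>E i\<in>I. A i)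
      = emeasure (\<Pi>\<^sub>M j\<in>h ` I. lborel) (\<Pi>\<^sub>E j\<in>h ` I. A (the_inv_into I h j))"
      by (subst emeasure_distr[OF meas]) simp_all
    also have "\<dots> = (\<Prod>j\<in>h ` I. emeasure lborel (A (the_inv_into I h j)))"
      using A assms(1) by (intro J.emeasure_PiM) (auto simp: the_inv_into_f_f[OF assms(2)])
    also have "\<dots> = (\<Prod>i\<in>I. emeasure lborel (A i))"
      by (simp add: prod.reindex[OF assms(2)] the_inv_into_f_f[OF assms(2)])
    finally show "emeasure (distr (\<Pi>\<^sub>M j\<in>h ` I. lborel) (\<Pi>\<^sub>M k\<in>I. lborel) (\<lambda>f. \<lambda>k\<in>I. f (h k))) (\<Pi>\<^sub>E i\<in>I. A i)
      = (\<Prod>i\<in>I. emeasure lborel (A i))" .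
  qed (use assms in auto)
qed

lemma gaussian_exponent_cong:
  assumes "\<And>i. i \<in> I \<Longrightarrow> w i = w' i"
  shows "gaussian_exponent I A b w = gaussian_exponent I A b w'"
  using assms by (simp add: gaussian_exponent_def)

text \<open>Both iterated integrals are transported to the \<open>Inl\<close> and \<open>Inr\<close>
  halves of \<open>idx N\<close> and then merged by Fubini.\<close>

lemma gaussian_integral_idx:
  fixes A :: "'d::finite + nat \<Rightarrow> 'd + nat \<Rightarrow> complex"
  assumes "coercive_on (idx N) A"
  shows "(\<integral>y. (\<integral>\<theta>. exp (gaussian_exponent (idx N) A b
      (join (cvec y) (\<lambda>k. complex_of_real (\<theta> k)))) \<partial>(\<Pi>\<^sub>M k\<in>{..<N}. lborel)) \<partial>(lborel :: (real^'d) measure))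
    = gaussian_integral (idx N) A b"
proof -
  interpret product_sigma_finite "\<lambda>_::'d + nat. lborel :: real measure" by standard
  interpret N: product_sigma_finite "\<lambda>_::nat. lborel :: real measure" by standard
  interpret N: finite_product_sigma_finite "\<lambda>_::nat. lborel :: real measure" "{..<N}" by standard simp
  let ?X = "\<Pi>\<^sub>M k\<in>range (Inl :: 'd \<Rightarrow> 'd + nat). (lborel :: real measure)"
  let ?T = "\<Pi>\<^sub>M k\<in>(Inr :: nat \<Rightarrow> 'd + nat) ` {..<N}. (lborel :: real measure)"
  let ?E = "\<lambda>w. exp (gaussian_exponent (idx N) A b w)"
  let ?g = "\<lambda>y \<theta>. ?E (join (cvec y) (\<lambda>k. complex_of_real (\<theta> k)))"
  \<comment> \<open>Joint measurability makes the inner integral measurable in \<open>y\<close>, as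
    the change of variables for the outer one requires.\<close>
  have meas: "(\<lambda>(y, \<theta>). ?g y \<theta>) \<in> borel_measurable (borel \<Otimes>\<^sub>M (\<Pi>\<^sub>M k\<in>{..<N}. (lborel :: real measure)))"
  proof -
    have [measurable]: "(\<lambda>x. snd x k) \<in> borel_measurable (borel \<Otimes>\<^sub>M (\<Pi>\<^sub>M k\<in>{..<N}. (lborel :: real measure)))"
      if "k \<in> {..<N}" for k
    proof -
      have "(\<lambda>x. snd x k) \<in> borel \<Otimes>\<^sub>M (\<Pi>\<^sub>M k\<in>{..<N}. lborel) \<rightarrow>\<^sub>M (lborel :: real measure)"
        by (rule measurable_compose[OF measurable_snd measurable_component_singleton[OF that]])
      then show ?thesis by simp
    qed
    have [measurable]: "(\<lambda>x. fst x $ i)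
      \<in> borel_measurable ((borel :: (real^'d) measure) \<Otimes>\<^sub>M (\<Pi>\<^sub>M k\<in>{..<N}. (lborel :: real measure)))" for i
      by (intro measurable_compose[OF measurable_fst] borel_measurable_continuous_onI continuous_intros)
    show ?thesis
      unfolding gaussian_exponent_def sum_idx join_def cvec_def sum.case vec_lambda_beta case_prod_beta
      by measurable
  qed
  have meas\<theta>: "?g y \<in> borel_measurable (\<Pi>\<^sub>M k\<in>{..<N}. (lborel :: real measure))" for y
    using measurable_compose_Pair1[OF _ meas, of y] by simp
  have measX: "(\<lambda>f. \<chi> i. f (Inl i)) \<in> ?X \<rightarrow>\<^sub>M (borel :: (real^'d) measure)"
    by (subst borel_measurable_euclidean_space) (auto simp: Basis_vec_def inner_axis)
  have measT: "(\<lambda>f. \<lambda>k\<in>{..<N}. f (Inr k)) \<in> ?T \<rightarrow>\<^sub>M (\<Pi>\<^sub>M k\<in>{..<N}. (lborel :: real measure))"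
    by (rule measurable_restrict) simp
  have "(\<integral>y. (\<integral>\<theta>. ?g y \<theta> \<partial>(\<Pi>\<^sub>M k\<in>{..<N}. lborel)) \<partial>(lborel :: (real^'d) measure))
    = (\<integral>f. (\<integral>\<theta>. ?g (\<chi> i. f (Inl i)) \<theta> \<partial>(\<Pi>\<^sub>M k\<in>{..<N}. lborel)) \<partial>?X)"
    unfolding lborel_vec_eq_distr
    by (rule integral_distr[OF measX, where f = "\<lambda>y. (\<integral>\<theta>. ?g y \<theta> \<partial>(\<Pi>\<^sub>M k\<in>{..<N}. lborel))"]) (rule N.borel_measurable_lebesgue_integral[OF meas])
  also have "\<dots> = (\<integral>f. (\<integral>h. ?g (\<chi> i. f (Inl i)) (\<lambda>k\<in>{..<N}. h (Inr k)) \<partial>?T) \<partial>?X)"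
  proof (rule arg_cong[where f = "integral\<^sup>L ?X"], rule ext)
    fix f :: "'d + nat \<Rightarrow> real"
    let ?y = "\<chi> i. f (Inl i)"
    have "integral\<^sup>L (\<Pi>\<^sub>M k\<in>{..<N}. lborel) (?g ?y)
      = integral\<^sup>L (distr ?T (\<Pi>\<^sub>M k\<in>{..<N}. lborel) (\<lambda>f. \<lambda>k\<in>{..<N}. f (Inr k))) (?g ?y)"
      by (rule arg_cong2[where f = "integral\<^sup>L", OF PiM_reindex_distr refl]) simp_all
    also have "\<dots> = (\<integral>h. ?g ?y (\<lambda>k\<in>{..<N}. h (Inr k)) \<partial>?T)"
      by (rule integral_distr[OF measT meas\<theta>])
    finally show "(\<integral>\<theta>. ?g ?y \<theta> \<partial>(\<Pi>\<^sub>M k\<in>{..<N}. lborel))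
      = (\<integral>h. ?g ?y (\<lambda>k\<in>{..<N}. h (Inr k)) \<partial>?T)" .
  qed
  also have "\<dots> = (\<integral>f. (\<integral>h. ?E (\<lambda>i. complex_of_real (merge (range Inl) (Inr ` {..<N}) (f, h) i)) \<partial>?T) \<partial>?X)"
    by (intro Bochner_Integration.integral_cong refl arg_cong[where f = exp] gaussian_exponent_cong)
      (auto simp: idx_def join_def cvec_def merge_def)
  also have "\<dots> = gaussian_integral (idx N) A b"
    unfolding gaussian_integral_def idx_def
    by (rule product_integral_fold[symmetric, where f = "\<lambda>w. exp (gaussian_exponent (range Inl \<union> Inr ` {..<N}) A b
      (\<lambda>i. complex_of_real (w i)))"])
      (use integrable_gaussian[OF finite_idx assms, of b] in \<open>auto simp: idx_def\<close>)
  finally show ?thesis .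
qed

subsection \<open>The short-time Fourier transform as a Gaussian integral\<close>

lemma generator_symD:
  "gaussian_generator P N \<Longrightarrow> i \<in> idx N \<Longrightarrow> j \<in> idx N \<Longrightarrow> P i j = P j i"
  by (auto simp: gaussian_generator_def)

lemma generator_injD:
  assumes "gaussian_generator P N" "\<And>j. j \<in> idx N \<Longrightarrow> (\<Sum>k<N. c k * P (Inr k) j) = 0" "k < N"
  shows "c k = 0"
  using assms unfolding gaussian_generator_def by blast

text \<open>By symmetry of \<open>P\<close> the mixed terms with \<open>Re (P i j)\<close> cancel,
  leaving the form of Im P at \<open>Re (w i)\<close> plus that at \<open>Im (w i)\<close>.\<close>

lemma generator_Im_nonneg:
  assumes gen: "gaussian_generator P N"
  shows "0 \<le> Im (\<Sum>i\<in>idx N. cnj (w i) * (\<Sum>j\<in>idx N. P i j * w j))"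
proof -
  let ?R = "\<lambda>i j. Re (w i) * Im (w j) * Re (P i j)"
  have "(\<Sum>i\<in>idx N. \<Sum>j\<in>idx N. ?R i j) = (\<Sum>j\<in>idx N. \<Sum>i\<in>idx N. ?R i j)"
    by (rule sum.swap)
  also have "\<dots> = (\<Sum>i\<in>idx N. \<Sum>j\<in>idx N. Im (w i) * Re (w j) * Re (P i j))"
    using generator_symD[OF gen] by (intro sum.cong refl) (simp add: mult_ac)
  finally have swap: "(\<Sum>i\<in>idx N. \<Sum>j\<in>idx N. ?R i j) = \<dots>" .
  have "Im (\<Sum>i\<in>idx N. cnj (w i) * (\<Sum>j\<in>idx N. P i j * w j))
    = (\<Sum>i\<in>idx N. \<Sum>j\<in>idx N. Re (w i) * Im (P i j) * Re (w j) + Im (w i) * Im (P i j) * Im (w j)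
        + (?R i j - Im (w i) * Re (w j) * Re (P i j)))"
    unfolding Im_sum sum_distrib_left by (intro sum.cong refl) (simp add: algebra_simps)
  also have "\<dots> = (\<Sum>i\<in>idx N. \<Sum>j\<in>idx N. Re (w i) * Im (P i j) * Re (w j))
    + (\<Sum>i\<in>idx N. \<Sum>j\<in>idx N. Im (w i) * Im (P i j) * Im (w j))"
    using swap by (simp add: sum.distrib sum_subtractf)
  also have "\<dots> \<ge> 0"
  proof -
    have "0 \<le> (\<Sum>i\<in>idx N. \<Sum>j\<in>idx N. v i * Im (P i j) * v j)" for v
      using gen unfolding gaussian_generator_def by blast
    then show ?thesis by (intro add_nonneg_nonneg)
  qed
  finally show ?thesis .
qed

text \<open>Along coordinate \<open>k\<close> the form is a quadratic polynomial in
  \<open>t\<close>; symmetry merges the row and column contributions to its linear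
  coefficient.\<close>

lemma pderiv_q_eq:
  assumes gen: "gaussian_generator P N" and k: "k \<in> idx N"
  shows "pderiv_q P N w k = 2 * (\<Sum>j\<in>idx N. P k j * w j)"
proof -
  let ?e = "\<lambda>i. if i = k then 1 else (0::complex)"
  let ?s = "\<Sum>j\<in>idx N. P k j * w j"
  have s: "(\<Sum>i\<in>idx N. w i * P i k) = ?s"
    using generator_symD[OF gen _ k] by (intro sum.cong refl) (simp add: mult.commute)
  have "qform P N (w(k := w k + t)) = qform P N w + 2 * ?s * t + P k k * t\<^sup>2" for t
  proof -
    have "qform P N (w(k := w k + t)) = (\<Sum>i\<in>idx N. \<Sum>j\<in>idx N. w i * P i j * w j
      + t * (if j = k then w i * P i k else 0) + (if i = k then t * (P k j * w j) + t\<^sup>2 * (if j = k then P k k else 0) else 0))"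
      unfolding qform_def by (intro sum.cong refl) (simp add: algebra_simps power2_eq_square)
    also have "\<dots> = qform P N w + t * (\<Sum>i\<in>idx N. w i * P i k) + (t * ?s + t\<^sup>2 * P k k)"
    proof -
      have "(\<Sum>j\<in>idx N. if i = k then t * (P k j * w j) + t\<^sup>2 * (if j = k then P k k else 0) else 0)
        = (if i = k then t * ?s + t\<^sup>2 * P k k else 0)" for i
        using k by (simp add: sum.distrib flip: sum_distrib_left)
      then show ?thesis
        using k by (simp add: sum.distrib qform_def flip: sum_distrib_left)
    qed
    finally show ?thesis unfolding s by (simp add: algebra_simps)
  qed
  moreover have "((\<lambda>t. qform P N w + 2 * ?s * t + P k k * t\<^sup>2) has_field_derivative 2 * ?s) (at 0)"
    by (auto intro!: derivative_eq_intros)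
  ultimately show ?thesis unfolding pderiv_q_def by (simp add: DERIV_imp_deriv)
qed

text \<open>The entries 1/2 come from the quadratic part of the window and \<epsilon> from the
  cut-off. In \<open>stft_vector\<close>, x comes from the cross term of the shifted window and
  -i\<xi> from the modulation.\<close>

definition stft_matrix :: "('d + nat \<Rightarrow> 'd + nat \<Rightarrow> complex) \<Rightarrow> real \<Rightarrow> 'd + nat \<Rightarrow> 'd + nat \<Rightarrow> complex" where
  "stft_matrix P \<epsilon> i j = - \<i> * P i j + (if i = j then case_sum (\<lambda>_. 1/2) (\<lambda>_. complex_of_real \<epsilon>) i else 0)"

definition stft_vector :: "(real^'d) \<times> (real^'d) \<Rightarrow> 'd + nat \<Rightarrow> complex" where
  "stft_vector z = case_sum (\<lambda>i. Complex (fst z $ i) (- snd z $ i)) (\<lambda>_. 0)"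

lemma stft_matrix_mult:
  fixes P :: "'d::finite + nat \<Rightarrow> 'd + nat \<Rightarrow> complex"
  assumes "i \<in> idx N"
  shows "(\<Sum>j\<in>idx N. stft_matrix P \<epsilon> i j * w j)
    = - \<i> * (\<Sum>j\<in>idx N. P i j * w j) + case_sum (\<lambda>_. 1/2) (\<lambda>_. complex_of_real \<epsilon>) i * w i"
proof -
  have "stft_matrix P \<epsilon> i j * w j = - \<i> * (P i j * w j)
    + (if j = i then case_sum (\<lambda>_. 1/2) (\<lambda>_. complex_of_real \<epsilon>) i * w i else 0)" for j
    by (auto simp: stft_matrix_def algebra_simps)
  then show ?thesis
    using assms by (simp add: sum_subtractf flip: sum_distrib_left)
qed

text \<open>Multiplication by -i turns the nonnegative imaginary part of the form of
  \<open>P\<close> into a real part. At \<epsilon> = 0 the bound still controls the position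
  variables.\<close>

lemma Re_stft_form:
  fixes P :: "'d::finite + nat \<Rightarrow> 'd + nat \<Rightarrow> complex"
  assumes gen: "gaussian_generator P N"
  shows "(\<Sum>i\<in>UNIV. (cmod (w (Inl i)))\<^sup>2) / 2 + \<epsilon> * (\<Sum>k<N. (cmod (w (Inr k)))\<^sup>2)
    \<le> Re (\<Sum>i\<in>idx N. cnj (w i) * (\<Sum>j\<in>idx N. stft_matrix P \<epsilon> i j * w j))"
proof -
  have sq: "Re (cnj z * (complex_of_real c * z)) = c * (cmod z)\<^sup>2" for z c
    unfolding cmod_power2 by (simp add: algebra_simps power2_eq_square)
  have "(\<Sum>i\<in>idx N. cnj (w i) * (\<Sum>j\<in>idx N. stft_matrix P \<epsilon> i j * w j))
    = (\<Sum>i\<in>idx N. - \<i> * (cnj (w i) * (\<Sum>j\<in>idx N. P i j * w j)))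
      + (\<Sum>i\<in>idx N. cnj (w i) * (case_sum (\<lambda>_. 1/2) (\<lambda>_. complex_of_real \<epsilon>) i * w i))"
    unfolding sum.distrib[symmetric]
    by (intro sum.cong refl) (subst stft_matrix_mult, assumption, simp add: algebra_simps)
  also have "(\<Sum>i\<in>idx N. - \<i> * (cnj (w i) * (\<Sum>j\<in>idx N. P i j * w j)))
    = - \<i> * (\<Sum>i\<in>idx N. cnj (w i) * (\<Sum>j\<in>idx N. P i j * w j))"
    by (rule sum_distrib_left[symmetric])
  also have "Re (- \<i> * (\<Sum>i\<in>idx N. cnj (w i) * (\<Sum>j\<in>idx N. P i j * w j))
      + (\<Sum>i\<in>idx N. cnj (w i) * (case_sum (\<lambda>_. 1/2) (\<lambda>_. complex_of_real \<epsilon>) i * w i)))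
    = Im (\<Sum>i\<in>idx N. cnj (w i) * (\<Sum>j\<in>idx N. P i j * w j))
      + ((\<Sum>i\<in>UNIV. (cmod (w (Inl i)))\<^sup>2) / 2 + \<epsilon> * (\<Sum>k<N. (cmod (w (Inr k)))\<^sup>2))"
    using sq[of _ "1/2"] sq[of _ \<epsilon>]
    by (simp add: sum_idx sum_divide_distrib sum_distrib_left del: complex_cnj_mult times_complex.sel)
  finally show ?thesis using generator_Im_nonneg[OF gen, of w] by simp
qed

text \<open>For \<epsilon> > 0 the constant \<open>min (1/2) \<epsilon>\<close> gives coercivity. At
  \<epsilon> = 0 the real part forces the position entries of a kernel vector to vanish; its
  \<theta>-entries are then coefficients of a linear relation among the rows of (P_\<theta>x
  P_\<theta>\<theta>), hence zero.\<close>

lemma gaussian_family_stft: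
  fixes P :: "'d::finite + nat \<Rightarrow> 'd + nat \<Rightarrow> complex"
  assumes gen: "gaussian_generator P N"
  shows "gaussian_family (at_right 0) (idx N) (stft_matrix P) (stft_matrix P 0)"
  unfolding gaussian_family_def
proof (intro conjI ballI allI impI)
  have "coercive_on (idx N) (stft_matrix P \<epsilon>)" if "\<epsilon> > 0" for \<epsilon>
    unfolding coercive_on_def
  proof (intro exI[of _ "min (1/2) \<epsilon>"] conjI allI)
    fix w :: "'d + nat \<Rightarrow> complex"
    let ?S = "\<Sum>i\<in>UNIV. (cmod (w (Inl i)))\<^sup>2" and ?T = "\<Sum>k<N. (cmod (w (Inr k)))\<^sup>2"
    have "min (1/2) \<epsilon> * (\<Sum>i\<in>idx N. (cmod (w i))\<^sup>2) = min (1/2) \<epsilon> * ?S + min (1/2) \<epsilon> * ?T"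
      by (simp add: sum_idx distrib_left)
    also have "\<dots> \<le> 1/2 * ?S + \<epsilon> * ?T"
      by (intro add_mono mult_right_mono sum_nonneg) auto
    also have "\<dots> \<le> Re (\<Sum>i\<in>idx N. cnj (w i) * (\<Sum>j\<in>idx N. stft_matrix P \<epsilon> i j * w j))"
      using Re_stft_form[OF gen, of w \<epsilon>] by simp
    finally show "min (1/2) \<epsilon> * (\<Sum>i\<in>idx N. (cmod (w i))\<^sup>2)
      \<le> Re (\<Sum>i\<in>idx N. cnj (w i) * (\<Sum>j\<in>idx N. stft_matrix P \<epsilon> i j * w j))" .
  qed (use that in simp)
  moreover have "\<forall>i\<in>idx N. \<forall>j\<in>idx N. stft_matrix P \<epsilon> i j = stft_matrix P \<epsilon> j i" for \<epsilon>
    using generator_symD[OF gen] by (auto simp: stft_matrix_def)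
  ultimately show "\<forall>\<^sub>F \<epsilon> in at_right 0. coercive_on (idx N) (stft_matrix P \<epsilon>)
      \<and> (\<forall>i\<in>idx N. \<forall>j\<in>idx N. stft_matrix P \<epsilon> i j = stft_matrix P \<epsilon> j i)"
    unfolding eventually_at_right_field by (intro exI[of _ 1]) auto
next
  fix i j :: "'d + nat"
  show "((\<lambda>\<epsilon>. stft_matrix P \<epsilon> i j) \<longlongrightarrow> stft_matrix P 0 i j) (at_right 0)"
    unfolding stft_matrix_def
    by (cases i) (auto intro!: tendsto_eq_intros)
next
  fix v :: "'d + nat \<Rightarrow> complex" and i :: "'d + nat"
  assume 0: "\<forall>i\<in>idx N. (\<Sum>j\<in>idx N. stft_matrix P 0 i j * v j) = 0" and i: "i \<in> idx N"
  have "(\<Sum>i\<in>UNIV. (cmod (v (Inl i)))\<^sup>2) \<le> 0"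
    using Re_stft_form[OF gen, of v 0] 0 by simp
  then have "(\<Sum>i\<in>UNIV. (cmod (v (Inl i)))\<^sup>2) = 0"
    by (meson antisym sum_nonneg zero_le_power2)
  then have x: "v (Inl i) = 0" for i
    by (simp add: sum_nonneg_eq_0_iff)
  have "(\<Sum>k<N. v (Inr k) * P (Inr k) j) = 0" if j: "j \<in> idx N" for j
  proof -
    have "(\<Sum>q\<in>idx N. P j q * v q) = 0"
      using bspec[OF 0 j] x unfolding stft_matrix_mult[OF j] by (cases j) auto
    then have "(\<Sum>k<N. P j (Inr k) * v (Inr k)) = 0"
      by (simp add: sum_idx x)
    also have "(\<Sum>k<N. P j (Inr k) * v (Inr k)) = (\<Sum>k<N. v (Inr k) * P (Inr k) j)"
      using generator_symD[OF gen j] by (intro sum.cong refl) (simp add: mult.commute)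
    finally show ?thesis .
  qed
  then have "v (Inr k) = 0" if "k < N" for k
    using generator_injD[OF gen, of "\<lambda>k. v (Inr k)"] that by blast
  then show "v i = 0" using i x by (cases i) auto
qed

section \<open>The regularised transform and its limit\<close>

lemma stft_integrand_eq:
  fixes P :: "'d::finite + nat \<Rightarrow> 'd + nat \<Rightarrow> complex"
  shows "exp (\<i> * qform P N (join (cvec y) (\<lambda>k. complex_of_real (\<theta> k)))
        - complex_of_real (\<epsilon> * (\<Sum>k<N. (\<theta> k)\<^sup>2)))
      * complex_of_real (window (y - x)) * exp (- \<i> * complex_of_real (inner y \<xi>))
    = complex_of_real (exp (- (norm x)\<^sup>2 / 2)) * exp (gaussian_exponent (idx N) (stft_matrix P \<epsilon>)
        (stft_vector (x, \<xi>)) (join (cvec y) (\<lambda>k. complex_of_real (\<theta> k))))"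
proof -
  let ?w = "join (cvec y) (\<lambda>k. complex_of_real (\<theta> k))"
  have w: "?w (Inl i) = of_real (y $ i)" "?w (Inr k) = of_real (\<theta> k)" for i k
    by (simp_all add: join_def cvec_def)
  have "(\<Sum>i\<in>idx N. ?w i * (\<Sum>j\<in>idx N. stft_matrix P \<epsilon> i j * ?w j))
    = - \<i> * qform P N ?w + (\<Sum>i\<in>idx N. ?w i * (case_sum (\<lambda>_. 1/2) (\<lambda>_. complex_of_real \<epsilon>) i * ?w i))"
  proof -
    have "(\<Sum>i\<in>idx N. ?w i * (\<Sum>j\<in>idx N. stft_matrix P \<epsilon> i j * ?w j))
      = (\<Sum>i\<in>idx N. - \<i> * (\<Sum>j\<in>idx N. ?w i * P i j * ?w j)
        + ?w i * (case_sum (\<lambda>_. 1/2) (\<lambda>_. complex_of_real \<epsilon>) i * ?w i))"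
      by (intro sum.cong refl) (simp add: stft_matrix_mult sum_distrib_left algebra_simps)
    then show ?thesis by (simp only: sum.distrib qform_def sum_distrib_left)
  qed
  also have "(\<Sum>i\<in>idx N. ?w i * (case_sum (\<lambda>_. 1/2) (\<lambda>_. complex_of_real \<epsilon>) i * ?w i))
    = complex_of_real ((norm y)\<^sup>2 / 2 + \<epsilon> * (\<Sum>k<N. (\<theta> k)\<^sup>2))"
    unfolding power2_norm_eq_inner inner_vec_def
    by (simp add: sum_idx w power2_eq_square sum_distrib_left sum_divide_distrib mult_ac)
  finally have 1: "(\<Sum>i\<in>idx N. ?w i * (\<Sum>j\<in>idx N. stft_matrix P \<epsilon> i j * ?w j))
    = - \<i> * qform P N ?w + complex_of_real ((norm y)\<^sup>2 / 2 + \<epsilon> * (\<Sum>k<N. (\<theta> k)\<^sup>2))" .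
  have 2: "(\<Sum>i\<in>idx N. stft_vector (x, \<xi>) i * ?w i) = of_real (inner y x) - \<i> * of_real (inner y \<xi>)"
    by (simp add: sum_idx stft_vector_def w inner_vec_def Complex_eq algebra_simps sum.distrib
        sum_subtractf sum_distrib_left)
  have 3: "(norm (y - x))\<^sup>2 = (norm y)\<^sup>2 - 2 * inner y x + (norm x)\<^sup>2"
    by (simp add: power2_norm_eq_inner inner_diff_left inner_diff_right inner_commute)
  have "\<i> * qform P N ?w - complex_of_real (\<epsilon> * (\<Sum>k<N. (\<theta> k)\<^sup>2))
      + complex_of_real (- (norm (y - x))\<^sup>2 / 2) + - \<i> * complex_of_real (inner y \<xi>)
    = complex_of_real (- (norm x)\<^sup>2 / 2) + gaussian_exponent (idx N) (stft_matrix P \<epsilon>) (stft_vector (x, \<xi>)) ?w"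
    unfolding gaussian_exponent_def 1 2 3 by (simp add: field_simps)
  from arg_cong[OF this, of exp] show ?thesis
    unfolding window_def exp_add by (simp only: exp_of_real[symmetric])
qed

text \<open>Only the linear term of the exponent depends on \<open>z\<close>, so one constant
  \<open>C\<close> serves all \<open>z\<close>; the decay estimate relies on this
  uniformity.\<close>

lemma stft_osc_eq:
  fixes P :: "'d::finite + nat \<Rightarrow> 'd + nat \<Rightarrow> complex"
  assumes gen: "gaussian_generator P N"
  obtains C where "\<And>z. \<exists>v. (\<forall>i\<in>idx N. 2 * (\<Sum>j\<in>idx N. stft_matrix P 0 i j * v j) = stft_vector z i) \<and>
    stft_osc P N z = complex_of_real (exp (- (norm (fst z))\<^sup>2 / 2)) * (C * exp ((\<Sum>i\<in>idx N. stft_vector z i * v i) / 2))"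
proof -
  note fam = gaussian_family_stft[OF gen]
  have bot: "at_right (0::real) \<noteq> bot" by simp
  from gaussian_limit_of_family[OF finite_idx bot fam] obtain C where
    C: "\<And>B b. \<forall>i\<in>idx N. ((\<lambda>\<epsilon>. B \<epsilon> i) \<longlongrightarrow> b i) (at_right 0) \<Longrightarrow>
      \<exists>v. (\<forall>i\<in>idx N. 2 * (\<Sum>j\<in>idx N. stft_matrix P 0 i j * v j) = b i) \<and>
       ((\<lambda>\<epsilon>. gaussian_integral (idx N) (stft_matrix P \<epsilon>) (B \<epsilon>)) \<longlongrightarrow> C * exp ((\<Sum>i\<in>idx N. b i * v i) / 2)) (at_right 0)"
    unfolding gaussian_limit_def by blast
  have "\<exists>v. (\<forall>i\<in>idx N. 2 * (\<Sum>j\<in>idx N. stft_matrix P 0 i j * v j) = stft_vector z i) \<and>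
    stft_osc P N z = complex_of_real (exp (- (norm (fst z))\<^sup>2 / 2)) * (C * exp ((\<Sum>i\<in>idx N. stft_vector z i * v i) / 2))" for z
  proof -
    obtain x \<xi> where z: "z = (x, \<xi>)" by fastforce
    from C[of "\<lambda>_. stft_vector z" "stft_vector z"] obtain v where
      v: "\<forall>i\<in>idx N. 2 * (\<Sum>j\<in>idx N. stft_matrix P 0 i j * v j) = stft_vector z i" and
      lim: "((\<lambda>\<epsilon>. gaussian_integral (idx N) (stft_matrix P \<epsilon>) (stft_vector z))
        \<longlongrightarrow> C * exp ((\<Sum>i\<in>idx N. stft_vector z i * v i) / 2)) (at_right 0)" by auto
    let ?K = "complex_of_real (exp (- (norm x)\<^sup>2 / 2))"
    let ?I = "\<lambda>\<epsilon>. integral\<^sup>L lborel (\<lambda>y :: real^'d.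
         integral\<^sup>L (PiM {..<N} (\<lambda>_. lborel)) (\<lambda>\<theta> :: nat \<Rightarrow> real.
           exp (\<i> * qform P N (join (cvec y) (\<lambda>k. complex_of_real (\<theta> k)))
                - complex_of_real (\<epsilon> * (\<Sum>k<N. (\<theta> k)\<^sup>2)))
           * complex_of_real (window (y - x))
           * exp (- \<i> * complex_of_real (inner y \<xi>))))"
    have "\<forall>\<^sub>F \<epsilon> in at_right 0. ?K * gaussian_integral (idx N) (stft_matrix P \<epsilon>) (stft_vector z) = ?I \<epsilon>"
    proof -
      have "\<forall>\<^sub>F \<epsilon> in at_right 0. coercive_on (idx N) (stft_matrix P \<epsilon>)"
        using fam unfolding gaussian_family_def by (auto elim: eventually_mono)
      then show ?thesis
      proof eventually_elim
        case (elim \<epsilon>)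
        show ?case
          unfolding stft_integrand_eq integral_mult_right_zero z gaussian_integral_idx[OF elim] ..
      qed
    qed
    from Lim_transform_eventually[OF tendsto_mult_left[OF lim, of ?K] this]
    have "stft_osc P N z = ?K * (C * exp ((\<Sum>i\<in>idx N. stft_vector z i * v i) / 2))"
      unfolding stft_osc_def z prod.case by (rule tendsto_Lim[OF bot])
    then show ?thesis using v z by auto
  qed
  then show thesis by (rule that)
qed

lemma polynomial_times_gaussian_bounded:
  fixes c n C :: real
  assumes "c > 0" "n \<ge> 0" "C \<ge> 0"
  shows "\<exists>K. \<forall>r::real. (1 + r\<^sup>2) powr (n / 2) * (C * exp (- c * r\<^sup>2)) \<le> K"
proof -
  \<comment> \<open>Adding 1 keeps \<open>m\<close> positive also for n = 0. With d = c/m, the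
    inequality ln t \<le> t - 1 at t = d(1 + r^2) bounds (1 + r^2)^m by a constant times exp(c(1 +
    r^2)).\<close>
  define m where "m = n / 2 + 1"
  define d where "d = c / m"
  have m: "m > 0" using assms by (simp add: m_def)
  then have d: "d > 0" using assms by (simp add: d_def)
  have "(1 + r\<^sup>2) powr (n / 2) * (C * exp (- c * r\<^sup>2)) \<le> C * exp (c - m - m * ln d)" for r :: real
  proof -
    let ?s = "1 + r\<^sup>2"
    have s: "?s \<ge> 1" by simp
    have "ln (d * ?s) \<le> d * ?s - 1" using d s by (intro ln_le_minus_one) (simp add: add_pos_nonneg)
    then have "ln ?s \<le> d * ?s - 1 - ln d" using d s by (simp add: ln_mult_pos add_pos_nonneg)
    then have "m * ln ?s \<le> m * (d * ?s - 1 - ln d)" using m by (intro mult_left_mono) auto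
    also have "\<dots> = c * ?s - m - m * ln d" using m by (simp add: d_def field_simps)
    finally have le: "m * ln ?s \<le> c * ?s - m - m * ln d" .
    have "?s powr (n / 2) \<le> ?s powr m" using s by (intro powr_mono) (auto simp: m_def)
    also have "\<dots> = exp (m * ln ?s)" using s by (simp add: powr_def add_nonneg_eq_0_iff)
    also have "\<dots> \<le> exp (c * ?s - m - m * ln d)" using le by simp
    finally have "?s powr (n / 2) * (C * exp (- c * r\<^sup>2)) \<le> exp (c * ?s - m - m * ln d) * (C * exp (- c * r\<^sup>2))"
      using assms by (intro mult_right_mono) auto
    also have "\<dots> = C * exp (c - m - m * ln d)"
      by (simp add: exp_add[symmetric] algebra_simps)
    finally show ?thesis .
  qed
  then show ?thesis by blast
qed

subsection \<open>The wave front set\<close>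

theorem theorem4p5:
  fixes P :: "'d::finite + nat \<Rightarrow> 'd + nat \<Rightarrow> complex" and N :: nat
  assumes "gaussian_generator P N"
  shows "gabor_wf (stft_osc P N) \<subseteq> real_part_lagr (lagrangian P N) - {0}"
proof -
  note gen = assms
  obtain C where C: "\<And>z. \<exists>v. (\<forall>i\<in>idx N. 2 * (\<Sum>j\<in>idx N. stft_matrix P 0 i j * v j) = stft_vector z i) \<and>
    stft_osc P N z = complex_of_real (exp (- (norm (fst z))\<^sup>2 / 2)) * (C * exp ((\<Sum>i\<in>idx N. stft_vector z i * v i) / 2))"
    using stft_osc_eq[OF gen] by blast
  from choice[OF allI[OF C]] obtain V where
    "\<forall>z. (\<forall>i\<in>idx N. 2 * (\<Sum>j\<in>idx N. stft_matrix P 0 i j * V z j) = stft_vector z i) \<and>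
      stft_osc P N z = complex_of_real (exp (- (norm (fst z))\<^sup>2 / 2)) * (C * exp ((\<Sum>i\<in>idx N. stft_vector z i * V z i) / 2))" ..
  then have
    V: "\<And>z i. i \<in> idx N \<Longrightarrow> 2 * (\<Sum>j\<in>idx N. stft_matrix P 0 i j * V z j) = stft_vector z i" and
    osc: "\<And>z. stft_osc P N z = complex_of_real (exp (- (norm (fst z))\<^sup>2 / 2))
      * (C * exp ((\<Sum>i\<in>idx N. stft_vector z i * V z i) / 2))"
    by blast+
  have inj: "\<forall>i\<in>idx N. v i = 0" if "\<forall>i\<in>idx N. (\<Sum>j\<in>idx N. stft_matrix P 0 i j * v j) = 0" for v
    using gaussian_family_stft[OF gen] that unfolding gaussian_family_def by blast
  define a where "a z = (\<chi> i. V z (Inl i) - of_real (fst z $ i))" for z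
  \<comment> \<open>The position rows of the critical point equation, multiplied by i: the momentum
    over the critical point is \<xi> - ia.\<close>
  have PV: "2 * (\<Sum>j\<in>idx N. P (Inl i) j * V z j) = of_real (snd z $ i) - \<i> * a z $ i" for z i
  proof -
    have "- 2 * \<i> * (\<Sum>j\<in>idx N. P (Inl i) j * V z j) + V z (Inl i) = of_real (fst z $ i) - \<i> * of_real (snd z $ i)"
      using V[of "Inl i" z] unfolding stft_matrix_mult[OF Inl_in_idx]
      by (simp add: stft_vector_def Complex_eq algebra_simps)
    then have "\<i> * (- 2 * \<i> * (\<Sum>j\<in>idx N. P (Inl i) j * V z j) + V z (Inl i))
      = \<i> * (of_real (fst z $ i) - \<i> * of_real (snd z $ i))" by simp
    then show ?thesis by (simp add: a_def algebra_simps)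
  qed
  \<comment> \<open>At \<epsilon> = 0 the \<theta>-rows have neither a diagonal term nor a
    right-hand side, which is the condition p'_\<theta> = 0.\<close>
  have PV0: "(\<Sum>j\<in>idx N. P (Inr k) j * V z j) = 0" if "k < N" for z k
    using V[of "Inr k" z] that by (simp add: stft_matrix_mult stft_vector_def)
  \<comment> \<open>\<open>V\<close> comes from choice and is arbitrary outside
    \<open>idx N\<close>. On \<open>idx N\<close> injectivity determines its values, which are
    therefore additive and real-homogeneous in \<open>z\<close>.\<close>
  have lin: "linear a"
  proof -
    have eq: "V z i = w i" if "\<forall>i\<in>idx N. 2 * (\<Sum>j\<in>idx N. stft_matrix P 0 i j * w j) = stft_vector z i" "i \<in> idx N" for z w i
    proof -
      have "\<forall>i\<in>idx N. (\<Sum>j\<in>idx N. stft_matrix P 0 i j * (V z j - w j)) = 0"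
      proof
        fix i :: "'d + nat" assume i: "i \<in> idx N"
        have "2 * (\<Sum>j\<in>idx N. stft_matrix P 0 i j * V z j) = 2 * (\<Sum>j\<in>idx N. stft_matrix P 0 i j * w j)"
          using V[OF i, of z] that(1) i by simp
        then show "(\<Sum>j\<in>idx N. stft_matrix P 0 i j * (V z j - w j)) = 0"
          by (simp add: right_diff_distrib sum_subtractf)
      qed
      from inj[OF this] that(2) show ?thesis by simp
    qed
    have add: "V (z + z') i = V z i + V z' i" if "i \<in> idx N" for z z' i
    proof (rule eq[OF _ that], rule ballI)
      fix i :: "'d + nat" assume i: "i \<in> idx N"
      show "2 * (\<Sum>j\<in>idx N. stft_matrix P 0 i j * (V z j + V z' j)) = stft_vector (z + z') i"
        using V[OF i, of z] V[OF i, of z']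
        by (cases i) (simp_all add: distrib_left sum.distrib stft_vector_def complex_eq_iff)
    qed
    have scale: "V (r *\<^sub>R z) i = of_real r * V z i" if "i \<in> idx N" for r z i
    proof (rule eq[OF _ that], rule ballI)
      fix i :: "'d + nat" assume i: "i \<in> idx N"
      have "2 * (\<Sum>j\<in>idx N. stft_matrix P 0 i j * (of_real r * V z j)) = of_real r * stft_vector z i"
        unfolding V[OF i, of z, symmetric] by (simp add: sum_distrib_left mult_ac)
      also have "\<dots> = stft_vector (r *\<^sub>R z) i"
        by (cases i) (simp_all add: stft_vector_def complex_eq_iff)
      finally show "2 * (\<Sum>j\<in>idx N. stft_matrix P 0 i j * (of_real r * V z j)) = stft_vector (r *\<^sub>R z) i" .
    qed
    show ?thesis
      by (rule linearI) (auto simp: a_def vec_eq_iff add scale algebra_simps scaleR_conv_of_real[where 'a = complex])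
  qed
  have bound: "norm (stft_osc P N z) \<le> cmod C * exp (- (norm (a z))\<^sup>2 / 2)" for z
  proof -
    let ?x = "\<lambda>i. fst z $ i" and ?\<xi> = "\<lambda>i. snd z $ i" and ?a = "\<lambda>i. a z $ i"
    have Vx: "V z (Inl i) = of_real (?x i) + ?a i" for i by (simp add: a_def)
    \<comment> \<open>By \<open>PV0\<close> only the position rows contribute, and there
      \<open>PV\<close> expresses the form through x, \<xi> and a.\<close>
    have "2 * (\<Sum>i\<in>idx N. cnj (V z i) * (\<Sum>j\<in>idx N. P i j * V z j))
      = (\<Sum>i\<in>UNIV. cnj (V z (Inl i)) * (2 * (\<Sum>j\<in>idx N. P (Inl i) j * V z j)))"
    proof -
      have "(\<Sum>i\<in>idx N. cnj (V z i) * (\<Sum>j\<in>idx N. P i j * V z j))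
        = (\<Sum>i\<in>UNIV. cnj (V z (Inl i)) * (\<Sum>j\<in>idx N. P (Inl i) j * V z j))"
        by (subst sum_idx) (simp add: PV0)
      then show ?thesis by (simp add: sum_distrib_left mult_ac)
    qed
    also have "\<dots> = (\<Sum>i\<in>UNIV. cnj (of_real (?x i) + ?a i) * (of_real (?\<xi> i) - \<i> * ?a i))"
      unfolding PV Vx ..
    finally have "Im (2 * (\<Sum>i\<in>idx N. cnj (V z i) * (\<Sum>j\<in>idx N. P i j * V z j)))
      = (\<Sum>i\<in>UNIV. Im (cnj (of_real (?x i) + ?a i) * (of_real (?\<xi> i) - \<i> * ?a i)))" by simp
    also have "\<dots> = (\<Sum>i\<in>UNIV. - (?x i * Re (?a i) + ?\<xi> i * Im (?a i) + (cmod (?a i))\<^sup>2))"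
      unfolding cmod_power2 by (intro sum.cong refl) (simp add: algebra_simps power2_eq_square)
    finally have "Im (2 * (\<Sum>i\<in>idx N. cnj (V z i) * (\<Sum>j\<in>idx N. P i j * V z j)))
      = (\<Sum>i\<in>UNIV. - (?x i * Re (?a i) + ?\<xi> i * Im (?a i) + (cmod (?a i))\<^sup>2))" .
    moreover have "0 \<le> Im (2 * s)" if "0 \<le> Im s" for s
      using that by simp
    note this[OF generator_Im_nonneg[OF gen, of "V z"]]
    ultimately have key: "(\<Sum>i\<in>UNIV. ?x i * Re (?a i) + ?\<xi> i * Im (?a i)) + (\<Sum>i\<in>UNIV. (cmod (?a i))\<^sup>2) \<le> 0"
      unfolding sum_negf sum.distrib by linarith
    have na: "(\<Sum>i\<in>UNIV. (cmod (?a i))\<^sup>2) = (norm (a z))\<^sup>2"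
      by (simp add: norm_vec_def L2_set_def sum_nonneg)
    have nx: "(norm (fst z))\<^sup>2 = (\<Sum>i\<in>UNIV. ?x i * ?x i)"
      by (simp add: power2_norm_eq_inner inner_vec_def)
    \<comment> \<open>The real part of (x - i\<xi>)(x + a). By \<open>key\<close> the terms mixing a
      with x and \<xi> are at most -|a|^2, and |x|^2 cancels against the prefactor.\<close>
    have "Re (\<Sum>i\<in>idx N. stft_vector z i * V z i)
      = (\<Sum>i\<in>UNIV. ?x i * ?x i + (?x i * Re (?a i) + ?\<xi> i * Im (?a i)))"
      by (simp add: sum_idx stft_vector_def Vx algebra_simps)
    then have "Re (\<Sum>i\<in>idx N. stft_vector z i * V z i) \<le> (norm (fst z))\<^sup>2 - (norm (a z))\<^sup>2"
      using key unfolding na nx by (simp add: sum.distrib)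
    then have "exp (- (norm (fst z))\<^sup>2 / 2) * exp (Re (\<Sum>i\<in>idx N. stft_vector z i * V z i) / 2)
      \<le> exp (- (norm (a z))\<^sup>2 / 2)"
      unfolding exp_add[symmetric] by simp
    then have "cmod C * (exp (- (norm (fst z))\<^sup>2 / 2) * exp (Re (\<Sum>i\<in>idx N. stft_vector z i * V z i) / 2))
      \<le> cmod C * exp (- (norm (a z))\<^sup>2 / 2)"
      by (rule mult_left_mono) simp
    then show ?thesis unfolding osc by (simp add: norm_mult mult_ac)
  qed
  \<comment> \<open>If a = 0, the critical point lies exactly over (x, \<xi>), and its \<theta>-part
    is the required witness.\<close>
  have lagr: "z \<in> real_part_lagr (lagrangian P N)" if "a z = 0" for z
  proof -
    have x: "V z (Inl i) = of_real (fst z $ i)" for i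
      using that by (simp add: a_def vec_eq_iff)
    have "join (cvec (fst z)) (\<lambda>k. V z (Inr k)) = V z"
      by (rule ext) (auto simp: join_def cvec_def x split: sum.split)
    then have "(cvec (fst z), cvec (snd z)) \<in> lagrangian P N"
      unfolding lagrangian_def using PV[of _ z] PV0[of _ z] that
      by (auto intro!: exI[of _ "\<lambda>k. V z (Inr k)"] simp: pderiv_q_eq[OF gen] cvec_def)
    then show ?thesis by (simp add: real_part_lagr_def case_prod_beta)
  qed
  show ?thesis
  proof
    fix z0 assume z0: "z0 \<in> gabor_wf (stft_osc P N)"
    then have "z0 \<noteq> 0" by (simp add: gabor_wf_def)
    moreover have "a z0 = 0"
    proof (rule ccontr)
      assume "a z0 \<noteq> 0"
      \<comment> \<open>Half the ratio at \<open>z0\<close>, so that \<open>z0\<close> satisfies the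
        strict inequality of the cone.\<close>
      define c where "c = norm (a z0) / (2 * norm z0)"
      have c: "c > 0" using \<open>a z0 \<noteq> 0\<close> \<open>z0 \<noteq> 0\<close> by (simp add: c_def)
      \<comment> \<open>Linearity of \<open>a\<close> makes this open and conic, the strict
        inequality excludes 0, and Gaussian decay in |a| becomes Gaussian decay in |z|.\<close>
      define \<Gamma> where "\<Gamma> = {z. c * norm z < norm (a z)}"
      have "continuous_on UNIV a" using lin by (rule linear_continuous_on[OF linear_conv_bounded_linear[THEN iffD1]])
      then have "open \<Gamma>" unfolding \<Gamma>_def by (intro open_Collect_less continuous_intros)
      moreover have "conic \<Gamma>"
        by (auto simp: conic_def \<Gamma>_def linear_cmul[OF lin] mult.left_commute)
      moreover have "0 \<notin> \<Gamma>" by (simp add: \<Gamma>_def linear_0[OF lin])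
      moreover have "z0 \<in> \<Gamma>" using \<open>a z0 \<noteq> 0\<close> \<open>z0 \<noteq> 0\<close> by (simp add: \<Gamma>_def c_def)
      moreover have "\<exists>K. \<forall>z\<in>\<Gamma>. (1 + (norm z)\<^sup>2) powr (n / 2) * norm (stft_osc P N z) \<le> K" if "n \<ge> 0" for n :: real
      proof -
        obtain K where K: "\<And>r. (1 + r\<^sup>2) powr (n / 2) * (cmod C * exp (- (c\<^sup>2 / 2) * r\<^sup>2)) \<le> K"
          using polynomial_times_gaussian_bounded[of "c\<^sup>2 / 2" n "cmod C"] c \<open>n \<ge> 0\<close> by auto
        have "(1 + (norm z)\<^sup>2) powr (n / 2) * norm (stft_osc P N z) \<le> K" if "z \<in> \<Gamma>" for z
        proof -
          have "(c * norm z)\<^sup>2 \<le> (norm (a z))\<^sup>2"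
            using that c by (intro power_mono) (auto simp: \<Gamma>_def)
          then have "exp (- (norm (a z))\<^sup>2 / 2) \<le> exp (- (c\<^sup>2 / 2) * (norm z)\<^sup>2)"
            by (simp add: power_mult_distrib)
          then have "cmod C * exp (- (norm (a z))\<^sup>2 / 2) \<le> cmod C * exp (- (c\<^sup>2 / 2) * (norm z)\<^sup>2)"
            by (rule mult_left_mono) simp
          with bound[of z] have "norm (stft_osc P N z) \<le> cmod C * exp (- (c\<^sup>2 / 2) * (norm z)\<^sup>2)"
            by (rule order_trans)
          then have "(1 + (norm z)\<^sup>2) powr (n / 2) * norm (stft_osc P N z)
            \<le> (1 + (norm z)\<^sup>2) powr (n / 2) * (cmod C * exp (- (c\<^sup>2 / 2) * (norm z)\<^sup>2))"
            by (rule mult_left_mono) simp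
          also have "\<dots> \<le> K" by (rule K)
          finally show ?thesis .
        qed
        then show ?thesis by blast
      qed
      ultimately show False using z0 unfolding gabor_wf_def by blast
    qed
    ultimately show "z0 \<in> real_part_lagr (lagrangian P N) - {0}" using lagr by blast
  qed
qed

end
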